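(* Let $n\ge2$. Let $X_{\mathcal D_n}=\{h_{ij}:1\le i<j\le n\}$ be an alphabet, let $\delta:X_{\mathcal D_n}^*\to\mathcal D_n$ be the monoid morphism determined by $h_{ij}\mapsto\overline h_{ij}$, and let $R_{\mathcal D_n}$ be the following set of relations over $X_{\mathcal D_n}$ (with all indices in $\{1,\dots,n\}$): $$h_{ij}h_{kl}=h_{kl}\ \text{ if } k\le i<j\le l,\qquad h_{ij}h_{kl}=h_{kl}h_{ij}\ \text{ if } i<j\le k<l,\qquad h_{ij}h_{jk}=h_{ik}h_{ij}=h_{ik}h_{jk}\ \text{ if } i<j<k.$$ Then the monoid $\mathcal D_n$ has monoid presentation $\langle X_{\mathcal D_n}:R_{\mathcal D_n}\rangle$ via $\delta$.
   Context: Partition monoid: let $\mathbf n=\{1,\dots,n\}$, and let $\mathbf n'=\{1',\dots,n'\}$ and $\mathbf n''=\{1'',\dots,n''\}$ be disjoint copies of $\mathbf n$; for $A\subseteq\mathbf n$ write $A'=\{x':x\in A\}$. The partition monoid $\mathcal P_n$ is the set of all set partitions of $\mathbf n\cup\mathbf n'$, with product defined as follows. For $a,b\in\mathcal P_n$, let $a^\downarrow$ be the partition of $\mathbf n\cup\mathbf n''$ obtained from $a$ by renaming each $x'$ as $x''$, and $b^\uparrow$ the partition of $\mathbf n''\cup\mathbf n'$ obtained from $b$ by renaming each $x\in\mathbf n$ as $x''$. Then $x,y\in\mathbf n\cup\mathbf n'$ belong to the same block of $ab$ iff they are related by the smallest equivalence relation on $\mathbf n\cup\mathbf n''\cup\mathbf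 n'$ that relates any two elements lying in a common block of $a^\downarrow$ or of $b^\uparrow$. The identity is the partition $1$ with blocks $\{x,x'\}$, $x\in\mathbf n$. The monoid $\mathcal D_n$: for non-empty $A,B\subseteq\mathbf n$, $A$ and $B$ are separated if $\max A<\min B$ or $\max B<\min A$; $A$ is nested by $B=\{j_1<\dots<j_l\}$ if $j_t<\min A\le\max A<j_{t+1}$ for some $1\le t<l$; $A,B$ are nested if one is nested by the other. An equivalence relation $\eta$ on $\mathbf n$ is planar if every pair of distinct $\eta$-classes is separated or nested. Given planar $\eta$, let $B_1<\dots<B_r$ be the $\eta$-classes not nested by any other $\eta$-class (listed so that $\max B_i<\min B_{i+1}$), let $C_1,\dots,C_s$ be the remaining classes, and let $A_i=\{x\in\mathbf n:\min B_i\le x\le\max B_i\}$. Then $d_\eta\in\mathcal P_n$ is the partition with blocks $A_i\cup B_i'$ ($1\le i\le r$) and $C_j'$ ($1\le j\le s$). $\mathcal D_n=\{d_\eta:\eta\text{ a planar equivalence on }\mathbf n\}$, which is a submonoid of $\mathcal P_n$. For $1\le i<j\le n$, $\overline h_{ij}\in\mathcal D_n$ is the partition with blocks $\{i,i+1,\dots,j\}\cup\{i',j'\}$, $\{x'\}$ for $i<x<j$, and $\{x,x'\}$ for $x<i$ or $x>j$ (it equals $d_\eta$ where $\eta$ is the equivalence whose only non-trivial class is $\{i,j\}$). Presentations: $X^*$ is the free monoid over $X$. A relation $u=v$ stands for the pair $(u,v)$. A monoid $M$ has monoid presentation $\langle X:R\rangle$ via $\delta:X^*\to M$ if $\delta$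 is a surjective monoid morphism whose kernel $\{(u,v):u\delta=v\delta\}$ is the congruence on $X^*$ generated by $R$. *)

theory Defs
  imports "HOL-Algebra.Group" "HOL-Library.Disjoint_Sets"
begin

text \<open>\<open>Up x\<close>, \<open>Dn x\<close> and \<open>Mid x\<close> stand for $x$, $x'$ and $x''$.\<close>

datatype vertex = Up nat | Dn nat | Mid nat

definition verts :: "nat \<Rightarrow> vertex set" where
  "verts n = Up ` {1..n} \<union> Dn ` {1..n}"

fun lower_to_mid :: "vertex \<Rightarrow> vertex" where
  "lower_to_mid (Up x) = Up x"
| "lower_to_mid (Dn x) = Mid x"
| "lower_to_mid (Mid x) = Mid x"

fun upper_to_mid :: "vertex \<Rightarrow> vertex" where
  "upper_to_mid (Up x) = Mid x"
| "upper_to_mid (Dn x) = Dn x"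
| "upper_to_mid (Mid x) = Mid x"

definition equiv_generated :: "'a set \<Rightarrow> ('a \<times> 'a) set \<Rightarrow> ('a \<times> 'a) set" where
  "equiv_generated V S = \<Inter>{r. equiv V r \<and> S \<subseteq> r}"

definition joint_rel :: "nat \<Rightarrow> vertex set set \<Rightarrow> vertex set set \<Rightarrow> (vertex \<times> vertex) set" where
  "joint_rel n a b = equiv_generated (verts n \<union> Mid ` {1..n})
     {(x, y). \<exists>C \<in> (`) lower_to_mid ` a \<union> (`) upper_to_mid ` b. x \<in> C \<and> y \<in> C}"

definition part_mult :: "nat \<Rightarrow> vertex set set \<Rightarrow> vertex set set \<Rightarrow> vertex set set" where
  "part_mult n a b = verts n // (joint_rel n a b \<inter> verts n \<times> verts n)"

definition partition_monoid :: "nat \<Rightarrow> vertex set set monoid" where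
  "partition_monoid n =
     \<lparr>carrier = {a. partition_on (verts n) a},
      mult = part_mult n,
      one = {{Up x, Dn x} |x. x \<in> {1..n}}\<rparr>"

text \<open>The next three notions are meant for finite non-empty sets.\<close>

definition separated :: "nat set \<Rightarrow> nat set \<Rightarrow> bool" where
  "separated A B \<longleftrightarrow> Max A < Min B \<or> Max B < Min A"

text \<open>With $B = \{j_1 < \dots < j_l\}$, the entry \<open>sorted_list_of_set B ! t\<close> is $j_{t+1}$.\<close>

definition nested_by :: "nat set \<Rightarrow> nat set \<Rightarrow> bool" where
  "nested_by A B \<longleftrightarrow>
     (\<exists>t. Suc t < card B \<and>
        sorted_list_of_set B ! t < Min A \<and> Min A \<le> Max A \<and>
        Max A < sorted_list_of_set B ! Suc t)"

definition nested :: "nat set \<Rightarrow> nat set \<Rightarrow> bool" where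
  "nested A B \<longleftrightarrow> nested_by A B \<or> nested_by B A"

definition planar :: "nat \<Rightarrow> (nat \<times> nat) set \<Rightarrow> bool" where
  "planar n \<eta> \<longleftrightarrow> equiv {1..n} \<eta> \<and>
     (\<forall>A \<in> {1..n} // \<eta>. \<forall>B \<in> {1..n} // \<eta>. A \<noteq> B \<longrightarrow> separated A B \<or> nested A B)"

definition outer_classes :: "nat \<Rightarrow> (nat \<times> nat) set \<Rightarrow> nat set set" where
  "outer_classes n \<eta> =
     {B \<in> {1..n} // \<eta>. \<not> (\<exists>C \<in> {1..n} // \<eta>. C \<noteq> B \<and> nested_by B C)}"

definition d_part :: "nat \<Rightarrow> (nat \<times> nat) set \<Rightarrow> vertex set set" where
  "d_part n \<eta> =
     {Up ` {x \<in> {1..n}. Min B \<le> x \<and> x \<le> Max B} \<union> Dn ` B |B. B \<in> outer_classes n \<eta>} \<union>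
     {Dn ` C |C. C \<in> {1..n} // \<eta> - outer_classes n \<eta>}"

definition D_monoid :: "nat \<Rightarrow> vertex set set monoid" where
  "D_monoid n = (partition_monoid n)\<lparr>carrier := {d_part n \<eta> |\<eta>. planar n \<eta>}\<rparr>"

definition h_part :: "nat \<Rightarrow> nat \<Rightarrow> nat \<Rightarrow> vertex set set" where
  "h_part n i j =
     {Up ` {i..j} \<union> {Dn i, Dn j}} \<union>
     {{Dn x} |x. i < x \<and> x < j} \<union>
     {{Up x, Dn x} |x. x \<in> {1..n} \<and> (x < i \<or> j < x)}"

definition free_monoid :: "'x set \<Rightarrow> 'x list monoid" where
  "free_monoid X = \<lparr>carrier = lists X, mult = (@), one = []\<rparr>"

definition is_congruence :: "('a, 'b) monoid_scheme \<Rightarrow> ('a \<times> 'a) set \<Rightarrow> bool" where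
  "is_congruence M r \<longleftrightarrow> equiv (carrier M) r \<and>
     (\<forall>a b c d. (a, b) \<in> r \<longrightarrow> (c, d) \<in> r \<longrightarrow> (a \<otimes>\<^bsub>M\<^esub> c, b \<otimes>\<^bsub>M\<^esub> d) \<in> r)"

text \<open>Only meaningful when \<open>R \<subseteq> carrier M \<times> carrier M\<close>; otherwise no congruence contains \<open>R\<close>.\<close>

definition congruence_generated :: "('a, 'b) monoid_scheme \<Rightarrow> ('a \<times> 'a) set \<Rightarrow> ('a \<times> 'a) set" where
  "congruence_generated M R = \<Inter>{r. is_congruence M r \<and> R \<subseteq> r}"

definition has_monoid_presentation ::
  "('a, 'b) monoid_scheme \<Rightarrow> 'x set \<Rightarrow> ('x list \<times> 'x list) set \<Rightarrow> ('x list \<Rightarrow> 'a) \<Rightarrow> bool" where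
  "has_monoid_presentation M X R \<delta> \<longleftrightarrow>
     monoid M \<and> R \<subseteq> lists X \<times> lists X \<and>
     \<delta> \<in> hom (free_monoid X) M \<and> \<delta> [] = \<one>\<^bsub>M\<^esub> \<and> \<delta> ` lists X = carrier M \<and>
     {(u, v). u \<in> lists X \<and> v \<in> lists X \<and> \<delta> u = \<delta> v} =
       congruence_generated (free_monoid X) R"

definition word_eval :: "('a, 'b) monoid_scheme \<Rightarrow> ('x \<Rightarrow> 'a) \<Rightarrow> 'x list \<Rightarrow> 'a" where
  "word_eval M f w = foldr (\<lambda>x y. f x \<otimes>\<^bsub>M\<^esub> y) w \<one>\<^bsub>M\<^esub>"

datatype letter = H nat nat

definition X_D :: "nat \<Rightarrow> letter set" where
  "X_D n = {H i j |i j. 1 \<le> i \<and> i < j \<and> j \<le> n}"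

fun letter_part :: "nat \<Rightarrow> letter \<Rightarrow> vertex set set" where
  "letter_part n (H i j) = h_part n i j"

definition \<delta>_D :: "nat \<Rightarrow> letter list \<Rightarrow> vertex set set" where
  "\<delta>_D n = word_eval (D_monoid n) (letter_part n)"

definition R_D :: "nat \<Rightarrow> (letter list \<times> letter list) set" where
  "R_D n =
     {([H i j, H k l], [H k l]) |i j k l.
        {i, j, k, l} \<subseteq> {1..n} \<and> k \<le> i \<and> i < j \<and> j \<le> l} \<union>
     {([H i j, H k l], [H k l, H i j]) |i j k l.
        {i, j, k, l} \<subseteq> {1..n} \<and> i < j \<and> j \<le> k \<and> k < l} \<union>
     {([H i j, H j k], [H i k, H i j]) |i j k.
        {i, j, k} \<subseteq> {1..n} \<and> i < j \<and> j < k} \<union>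
     {([H i k, H i j], [H i k, H j k]) |i j k.
        {i, j, k} \<subseteq> {1..n} \<and> i < j \<and> j < k}"

end

theory Submission
  imports Defs
begin

text \<open>A partition is determined by the 0-1-labellings of its vertices that are constant on blocks. Read as
  a relation between the labels of the upper and of the lower row, these turn the product of partitions
  into composition of relations, so associativity and the defining relations become statements about
  relations on subsets of \<open>{1..n}\<close>.

  A word is in normal form if its letters \<open>H a b\<close>, viewed as arcs from \<open>a\<close> to \<open>b\<close>, are sorted by strictly
  increasing left end points and do not cross. Such words are the lists of arcs between consecutive
  elements of the classes of planar (that is, noncrossing) equivalences \<open>\<eta>\<close>, and they evaluate to
  \<open>d_part n \<eta>\<close>, from which \<open>\<eta>\<close> can be recovered. Multiplying a normal form on the left by a letter and
  applying the relations yields a normal form again, so every word is congruent to exactly one normal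
  form, and congruence coincides with equality of values.\<close>

section \<open>Block-constant labellings\<close>

text \<open>The product restricts a generated equivalence, and arguing about it directly means
  following paths through the middle row. Dually, a labelling is constant on the classes of a
  generated equivalence as soon as it is constant on the generating blocks, so what remains is to
  choose the labels of the middle row; the witnesses called \<open>M\<close> below are such choices.
  Two labels suffice because the indicator of a single block already separates it from the others.
  Sorting by left end points isolates the first arc \<open>H a b\<close> of a normal word from the
  rest: in the equivalence of the remaining word, \<open>a\<close> is a singleton class and
  \<open>b\<close> the least point of its class. Prepending the arc adjoins one new least point to
  one class. This operation, \<open>link\<close>, matches composition with the relation of
  \<open>H a b\<close>, can be undone, and reaches every noncrossing equivalence. In the last family
  of relations, the equality of h_ik h_ij with h_ij h_jk serves when a new arc straddles the right
  end of the first one, and that of h_ik h_jk with h_ij h_jk when its right end lies under, or at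
  the end of, an arc starting inside it.\<close>

fun label :: "nat set \<Rightarrow> nat set \<Rightarrow> vertex \<Rightarrow> bool" where
  "label P Q (Up x) \<longleftrightarrow> x \<in> P"
| "label P Q (Dn x) \<longleftrightarrow> x \<in> Q"
| "label P Q (Mid x) \<longleftrightarrow> False"

text \<open>Confining both sets to \<open>{1..n}\<close> makes the pair determined by the labelling
  it induces on \<open>verts n\<close>, so these are relations on \<open>Pow {1..n}\<close>, with
  \<open>Id_on (Pow {1..n})\<close> for the identity partition.\<close>

definition labels :: "nat \<Rightarrow> vertex set set \<Rightarrow> (nat set \<times> nat set) set" where
  "labels n a = {(P, Q). P \<subseteq> {1..n} \<and> Q \<subseteq> {1..n} \<and>
     (\<forall>C \<in> a. \<forall>x \<in> C. \<forall>y \<in> C. label P Q x \<longleftrightarrow> label P Q y)}"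

lemma labelsI:
  assumes "P \<subseteq> {1..n}" "Q \<subseteq> {1..n}"
    and "\<And>C x y. C \<in> a \<Longrightarrow> x \<in> C \<Longrightarrow> y \<in> C \<Longrightarrow> label P Q x \<longleftrightarrow> label P Q y"
  shows "(P, Q) \<in> labels n a"
  using assms unfolding labels_def by blast

lemma labelsI_value:
  assumes "P \<subseteq> {1..n}" "Q \<subseteq> {1..n}"
    and "\<And>C. C \<in> a \<Longrightarrow> \<exists>v. \<forall>x \<in> C. label P Q x \<longleftrightarrow> v"
  shows "(P, Q) \<in> labels n a"
  using assms by (intro labelsI) blast+

lemma labels_subset:
  assumes "(P, Q) \<in> labels n a"
  shows "P \<subseteq> {1..n}" "Q \<subseteq> {1..n}"
  using assms unfolding labels_def by blast+

lemma labelsD: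
  assumes "(P, Q) \<in> labels n a" "C \<in> a" "x \<in> C" "y \<in> C"
  shows "label P Q x \<longleftrightarrow> label P Q y"
  using assms unfolding labels_def by blast

lemma partition_on_unique:
  assumes "partition_on A a" "C \<in> a" "D \<in> a" "x \<in> C" "x \<in> D"
  shows "C = D"
  using assms partition_onD2[OF assms(1)] disjointD by blast

text \<open>The indicator of a block \<open>D\<close> of \<open>b\<close> is a labelling of
  \<open>b\<close>, hence of \<open>a\<close>, so a block \<open>C\<close> of \<open>a\<close> that
  meets \<open>D\<close> lies inside it. By symmetry \<open>D\<close> lies inside some block
  \<open>E\<close> of \<open>a\<close>, and overlapping blocks of \<open>a\<close> are
  equal.\<close>

lemma labels_inj:
  assumes a: "partition_on (verts n) a" and b: "partition_on (verts n) b"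
    and eq: "labels n a = labels n b"
  shows "a = b"
proof -
  have sub: "\<exists>D \<in> b. C \<subseteq> D" if a: "partition_on (verts n) a" and b: "partition_on (verts n) b"
    and eq: "labels n a = labels n b" and C: "C \<in> a" for a b C
  proof -
    have Csub: "C \<subseteq> verts n" and "C \<noteq> {}"
      using a C partition_onD1 partition_onD3 by blast+
    then obtain v where v: "v \<in> C" by blast
    then obtain D where D: "D \<in> b" "v \<in> D"
      using b Csub partition_onD1 by blast
    have Dsub: "D \<subseteq> verts n"
      using b D partition_onD1 by blast
    define P Q where "P = {x. Up x \<in> D}" and "Q = {x. Dn x \<in> D}"
    have lab: "label P Q x \<longleftrightarrow> x \<in> D" if "x \<in> verts n" for x
      using that by (cases x) (auto simp: P_def Q_def verts_def)
    have "(P, Q) \<in> labels n b"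
    proof -
      have "label P Q x \<longleftrightarrow> label P Q y" if "E \<in> b" "x \<in> E" "y \<in> E" for E x y
      proof -
        have "x \<in> verts n" "y \<in> verts n"
          using that b partition_onD1 by blast+
        moreover have "x \<in> D \<longleftrightarrow> y \<in> D"
          using that D partition_on_unique[OF b] by blast
        ultimately show ?thesis using lab by blast
      qed
      moreover have "P \<subseteq> {1..n}" "Q \<subseteq> {1..n}"
        using Dsub by (auto simp: P_def Q_def verts_def)
      ultimately show ?thesis unfolding labels_def by blast
    qed
    then have "(P, Q) \<in> labels n a" using eq by simp
    then have "label P Q x" if "x \<in> C" for x
      using labelsD[OF _ C v that] v D lab Csub by blast
    then show ?thesis using lab Csub D by blast
  qed
  have "C \<in> b" if C: "C \<in> a" and a: "partition_on (verts n) a" and b: "partition_on (verts n) b"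
    and eq: "labels n a = labels n b" for a b C
  proof -
    obtain D where D: "D \<in> b" "C \<subseteq> D" using sub[OF a b eq C] by blast
    obtain E where E: "E \<in> a" "D \<subseteq> E" using sub[OF b a eq[symmetric] D(1)] by blast
    have "C \<noteq> {}" using a C partition_onD3 by blast
    then obtain x where "x \<in> C" by blast
    then have "C = E"
      using partition_on_unique[OF a C E(1), of x] E D by blast
    then show ?thesis using D E by auto
  qed
  from this[OF _ a b eq] this[OF _ b a eq[symmetric]] show ?thesis by blast
qed

section \<open>Products of partitions as compositions of labelling relations\<close>

lemma equiv_generated_props:
  assumes "S \<subseteq> V \<times> V"
  shows "equiv V (equiv_generated V S)" "S \<subseteq> equiv_generated V S"
    "\<And>r. equiv V r \<Longrightarrow> S \<subseteq> r \<Longrightarrow> equiv_generated V S \<subseteq> r"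
proof -
  \<comment> \<open>\<open>V \<times> V\<close> witnesses that the intersected family is nonempty;
    an empty one would yield the universal relation.\<close>
  have top: "equiv V (V \<times> V)"
    by (auto simp: equiv_def refl_on_def sym_def trans_def)
  show "equiv V (equiv_generated V S)"
  proof (rule equivI)
    show "equiv_generated V S \<subseteq> V \<times> V"
      using top assms unfolding equiv_generated_def by blast
    show "refl_on V (equiv_generated V S)"
      unfolding equiv_generated_def refl_on_def by (auto simp: equiv_def refl_on_def)
    show "sym (equiv_generated V S)"
      unfolding equiv_generated_def by (rule symI) (auto simp: equiv_def dest: symD)
    show "trans (equiv_generated V S)"
      unfolding equiv_generated_def by (rule transI) (auto simp: equiv_def dest: transD)
  qed
qed (auto simp: equiv_generated_def)

lemma equiv_joint_rel:
  assumes a: "\<Union>a \<subseteq> verts n" and b: "\<Union>b \<subseteq> verts n"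
  defines "V \<equiv> verts n \<union> Mid ` {1..n}"
  defines "G \<equiv> {(x, y). \<exists>C \<in> (`) lower_to_mid ` a \<union> (`) upper_to_mid ` b. x \<in> C \<and> y \<in> C}"
  shows "equiv V (joint_rel n a b)" "G \<subseteq> joint_rel n a b"
    "\<And>r. equiv V r \<Longrightarrow> G \<subseteq> r \<Longrightarrow> joint_rel n a b \<subseteq> r"
proof -
  have "lower_to_mid x \<in> V" "upper_to_mid x \<in> V" if "x \<in> verts n" for x
    using that by (auto simp: V_def verts_def)
  then have "G \<subseteq> V \<times> V"
    using a b unfolding G_def by blast
  from equiv_generated_props[OF this]
  show "equiv V (joint_rel n a b)" "G \<subseteq> joint_rel n a b"
    "\<And>r. equiv V r \<Longrightarrow> G \<subseteq> r \<Longrightarrow> joint_rel n a b \<subseteq> r"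
    unfolding joint_rel_def V_def G_def by auto
qed

lemma equiv_Restr:
  assumes "equiv V r" "W \<subseteq> V"
  shows "equiv W (r \<inter> W \<times> W)"
  using assms unfolding equiv_def refl_on_def sym_def trans_def by blast

lemma partition_on_part_mult:
  assumes "\<Union>a \<subseteq> verts n" "\<Union>b \<subseteq> verts n"
  shows "partition_on (verts n) (part_mult n a b)"
  unfolding part_mult_def
  by (intro partition_on_quotient equiv_Restr[OF equiv_joint_rel(1)[OF assms]]) auto

text \<open>A pair labels the product iff it extends over the middle row to a labelling that is
  constant on the joint classes. This amounts to being constant on the blocks of both factors, which
  share the middle labels \<open>M\<close>.\<close>

lemma labels_part_mult:
  assumes a: "\<Union>a \<subseteq> verts n" and b: "\<Union>b \<subseteq> verts n"
  shows "labels n (part_mult n a b) = labels n a O labels n b"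
proof -
  define V where "V = verts n \<union> Mid ` {1..n}"
  define J where "J = joint_rel n a b"
  define G where "G = {(x, y). \<exists>C \<in> (`) lower_to_mid ` a \<union> (`) upper_to_mid ` b. x \<in> C \<and> y \<in> C}"
  note J = equiv_joint_rel[OF a b, folded V_def J_def G_def]
  have Jsym: "(y, x) \<in> J" if "(x, y) \<in> J" for x y
    using J(1) that by (meson equivE symD)
  have Jtrans: "(x, z) \<in> J" if "(x, y) \<in> J" "(y, z) \<in> J" for x y z
    using J(1) that by (meson equivE transD)
  have Jrefl: "(x, x) \<in> J" if "x \<in> V" for x
    using J(1) that by (meson equivE refl_onD)
  have low: "(lower_to_mid x, lower_to_mid y) \<in> J" if "C \<in> a" "x \<in> C" "y \<in> C" for C x y
  proof -
    have "(lower_to_mid x, lower_to_mid y) \<in> G"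
      unfolding G_def using that by (auto intro!: bexI[of _ "lower_to_mid ` C"])
    then show ?thesis using J(2) by blast
  qed
  have upp: "(upper_to_mid x, upper_to_mid y) \<in> J" if "C \<in> b" "x \<in> C" "y \<in> C" for C x y
  proof -
    have "(upper_to_mid x, upper_to_mid y) \<in> G"
      unfolding G_def using that by (auto intro!: bexI[of _ "upper_to_mid ` C"])
    then show ?thesis using J(2) by blast
  qed
  have mem: "(P, Q) \<in> labels n (part_mult n a b) \<longleftrightarrow> P \<subseteq> {1..n} \<and> Q \<subseteq> {1..n} \<and>
     (\<forall>x \<in> verts n. \<forall>y \<in> verts n. (x, y) \<in> J \<longrightarrow> (label P Q x \<longleftrightarrow> label P Q y))" (is "?l \<longleftrightarrow> ?r") for P Q
  proof
    assume l: ?l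
    have "label P Q x \<longleftrightarrow> label P Q y" if "x \<in> verts n" "y \<in> verts n" "(x, y) \<in> J" for x y
    proof -
      have "(J \<inter> verts n \<times> verts n) `` {x} \<in> part_mult n a b"
        using that unfolding part_mult_def J_def by (auto intro: quotientI)
      moreover have "(x, x) \<in> J" using that Jrefl by (auto simp: V_def)
      ultimately show ?thesis using labelsD[OF l] that by blast
    qed
    then show ?r using labels_subset[OF l] by blast
  next
    assume r: ?r
    have "label P Q x \<longleftrightarrow> label P Q y" if C: "C \<in> part_mult n a b" "x \<in> C" "y \<in> C" for C x y
    proof -
      obtain z where "z \<in> verts n" "C = (J \<inter> verts n \<times> verts n) `` {z}"
        using C(1) unfolding part_mult_def J_def by (rule quotientE)
      then have "(z, x) \<in> J" "(z, y) \<in> J" "x \<in> verts n" "y \<in> verts n"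
        using C by blast+
      moreover from this have "(x, y) \<in> J" using Jsym Jtrans by meson
      ultimately show ?thesis using r by simp
    qed
    then show ?l using r by (intro labelsI; blast)
  qed
  show ?thesis
  proof (intro equalityI subrelI)
    fix P Q assume PQ: "(P, Q) \<in> labels n (part_mult n a b)"
    \<comment> \<open>A middle vertex inherits \<open>True\<close> from any vertex of
      \<open>verts n\<close> joined to it. A class that lies entirely in the middle row is labelled
      \<open>False\<close> throughout.\<close>
    define M where "M = {m \<in> {1..n}. \<exists>v \<in> verts n. (v, Mid m) \<in> J \<and> label P Q v}"
    define f where "f v = (case v of Mid m \<Rightarrow> m \<in> M | _ \<Rightarrow> label P Q v)" for v
    have const: "label P Q x \<longleftrightarrow> label P Q y"
      if "x \<in> verts n" "y \<in> verts n" "(x, y) \<in> J" for x y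
      using PQ that unfolding mem by blast
    have in_verts: "label P Q v \<longleftrightarrow> (\<exists>u \<in> verts n. (u, v) \<in> J \<and> label P Q u)"
      if "v \<in> verts n" for v
      using const[OF _ that] Jrefl[of v] that unfolding V_def by blast
    have f: "f v \<longleftrightarrow> (\<exists>u \<in> verts n. (u, v) \<in> J \<and> label P Q u)" if "v \<in> V" for v
    proof (cases v)
      case (Mid m)
      then have "m \<in> {1..n}" using that by (auto simp: V_def verts_def)
      then show ?thesis using Mid by (simp add: f_def M_def)
    next
      case (Up m)
      then have "v \<in> verts n" "f v \<longleftrightarrow> label P Q v"
        using that by (auto simp: V_def f_def)
      then show ?thesis using in_verts by blast
    next
      case (Dn m)
      then have "v \<in> verts n" "f v \<longleftrightarrow> label P Q v"
        using that by (auto simp: V_def f_def)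
      then show ?thesis using in_verts by blast
    qed
    have fJ: "f x \<longleftrightarrow> f y" if "(x, y) \<in> J" for x y
    proof -
      have "x \<in> V" "y \<in> V" using that J(1) by (auto simp: equiv_def)
      then show ?thesis using f that Jsym Jtrans by meson
    qed
    have fl: "f (lower_to_mid x) \<longleftrightarrow> label P M x" if "x \<in> verts n" for x
      using that by (auto simp: f_def verts_def)
    have fu: "f (upper_to_mid x) \<longleftrightarrow> label M Q x" if "x \<in> verts n" for x
      using that by (auto simp: f_def verts_def)
    have "label P M x \<longleftrightarrow> label P M y" if "C \<in> a" "x \<in> C" "y \<in> C" for C x y
      using fJ[OF low[OF that]] fl that a by blast
    moreover have "label M Q x \<longleftrightarrow> label M Q y" if "C \<in> b" "x \<in> C" "y \<in> C" for C x y
      using fJ[OF upp[OF that]] fu that b by blast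
    moreover have "M \<subseteq> {1..n}" by (auto simp: M_def)
    moreover have "P \<subseteq> {1..n}" "Q \<subseteq> {1..n}" using PQ labels_subset by blast+
    ultimately have "(P, M) \<in> labels n a" "(M, Q) \<in> labels n b"
      by (intro labelsI; blast)+
    then show "(P, Q) \<in> labels n a O labels n b" by blast
  next
    fix P Q assume "(P, Q) \<in> labels n a O labels n b"
    then obtain M where PM: "(P, M) \<in> labels n a" and MQ: "(M, Q) \<in> labels n b" by blast
    define f where "f v = (case v of Mid m \<Rightarrow> m \<in> M | _ \<Rightarrow> label P Q v)" for v
    \<comment> \<open>The kernel of \<open>f\<close> is an equivalence containing the generating
      pairs, so minimality of \<open>J\<close> replaces an induction along paths.\<close>
    define r where "r = {(x, y). x \<in> V \<and> y \<in> V \<and> f x = f y}"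
    have r: "equiv V r"
      by (auto simp: r_def equiv_def refl_on_def sym_def trans_def)
    have fl: "f (lower_to_mid x) \<longleftrightarrow> label P M x" if "x \<in> verts n" for x
      using that by (auto simp: f_def verts_def)
    have fu: "f (upper_to_mid x) \<longleftrightarrow> label M Q x" if "x \<in> verts n" for x
      using that by (auto simp: f_def verts_def)
    have vl: "lower_to_mid x \<in> V" "upper_to_mid x \<in> V" if "x \<in> verts n" for x
      using that by (auto simp: V_def verts_def)
    have "(lower_to_mid x, lower_to_mid y) \<in> r" if "C \<in> a" "x \<in> C" "y \<in> C" for C x y
    proof -
      have "x \<in> verts n" "y \<in> verts n" using that a by auto
      moreover have "label P M x \<longleftrightarrow> label P M y" by (rule labelsD[OF PM that])
      ultimately show ?thesis using fl vl unfolding r_def by blast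
    qed
    moreover have "(upper_to_mid x, upper_to_mid y) \<in> r" if "C \<in> b" "x \<in> C" "y \<in> C" for C x y
    proof -
      have "x \<in> verts n" "y \<in> verts n" using that b by auto
      moreover have "label M Q x \<longleftrightarrow> label M Q y" by (rule labelsD[OF MQ that])
      ultimately show ?thesis using fu vl unfolding r_def by blast
    qed
    ultimately have "G \<subseteq> r" unfolding G_def by auto
    then have "J \<subseteq> r" using J(3) r by blast
    moreover have "f v = label P Q v" if "v \<in> verts n" for v
      using that by (auto simp: f_def verts_def)
    ultimately show "(P, Q) \<in> labels n (part_mult n a b)"
      using labels_subset(1)[OF PM] labels_subset(2)[OF MQ] unfolding mem r_def by blast
  qed
qed

section \<open>The generators\<close>

text \<open>Strictly between \<open>i\<close> and \<open>j\<close> nothing links \<open>Q\<close> to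
  \<open>P\<close>, since those lower vertices are singleton blocks.\<close>

definition h_labels :: "nat \<Rightarrow> nat \<Rightarrow> nat \<Rightarrow> (nat set \<times> nat set) set" where
  "h_labels n i j = {(P, Q). P \<subseteq> {1..n} \<and> Q \<subseteq> {1..n} \<and> (\<forall>x. i < x \<and> x \<le> j \<longrightarrow> (x \<in> P \<longleftrightarrow> i \<in> P)) \<and>
     (i \<in> Q \<longleftrightarrow> i \<in> P) \<and> (j \<in> Q \<longleftrightarrow> i \<in> P) \<and> (\<forall>x. x < i \<or> j < x \<longrightarrow> (x \<in> Q \<longleftrightarrow> x \<in> P))}"

lemma labels_h_part:
  assumes "1 \<le> i" "i < j" "j \<le> n"
  shows "labels n (h_part n i j) = h_labels n i j"
proof (intro equalityI subrelI)
  fix P Q assume PQ: "(P, Q) \<in> labels n (h_part n i j)"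
  then have sub: "P \<subseteq> {1..n}" "Q \<subseteq> {1..n}" by (auto simp: labels_def)
  have c: "label P Q x \<longleftrightarrow> label P Q y" if "C \<in> h_part n i j" "x \<in> C" "y \<in> C" for C x y
    using PQ that unfolding labels_def by blast
  have big: "Up ` {i..j} \<union> {Dn i, Dn j} \<in> h_part n i j" by (auto simp: h_part_def)
  have "x \<in> P \<longleftrightarrow> i \<in> P" if "i < x \<and> x \<le> j" for x
    using c[OF big, of "Up x" "Up i"] that by auto
  moreover have "i \<in> Q \<longleftrightarrow> i \<in> P" "j \<in> Q \<longleftrightarrow> i \<in> P"
    using c[OF big, of "Dn i" "Up i"] c[OF big, of "Dn j" "Up i"] assms by auto
  moreover have "x \<in> Q \<longleftrightarrow> x \<in> P" if "x < i \<or> j < x" for x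
  proof (cases "x \<in> {1..n}")
    case True
    then have "{Up x, Dn x} \<in> h_part n i j" using that by (auto simp: h_part_def)
    from c[OF this, of "Dn x" "Up x"] show ?thesis by simp
  next
    case False
    then show ?thesis using sub by blast
  qed
  ultimately show "(P, Q) \<in> h_labels n i j" using sub unfolding h_labels_def by blast
next
  fix P Q assume PQ: "(P, Q) \<in> h_labels n i j"
  then have sub: "P \<subseteq> {1..n}" "Q \<subseteq> {1..n}"
    and P: "\<And>x. i < x \<and> x \<le> j \<Longrightarrow> x \<in> P \<longleftrightarrow> i \<in> P"
    and Q: "i \<in> Q \<longleftrightarrow> i \<in> P" "j \<in> Q \<longleftrightarrow> i \<in> P"
      "\<And>x. x < i \<or> j < x \<Longrightarrow> x \<in> Q \<longleftrightarrow> x \<in> P"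
    unfolding h_labels_def by blast+
  show "(P, Q) \<in> labels n (h_part n i j)"
  proof (rule labelsI_value[OF sub])
    fix C assume "C \<in> h_part n i j"
    then consider "C = Up ` {i..j} \<union> {Dn i, Dn j}" | x where "C = {Dn x}"
      | x where "C = {Up x, Dn x}" "x < i \<or> j < x"
      unfolding h_part_def by blast
    then show "\<exists>v. \<forall>x \<in> C. label P Q x \<longleftrightarrow> v"
    proof cases
      case 1
      have "label P Q x \<longleftrightarrow> i \<in> P" if "x \<in> Up ` {i..j}" for x
        using that P by (metis imageE label.simps(1) atLeastAtMost_iff le_neq_implies_less)
      moreover have "label P Q x \<longleftrightarrow> i \<in> P" if "x \<in> {Dn i, Dn j}" for x
        using that Q(1,2) by auto
      ultimately show ?thesis unfolding 1 by (intro exI[of _ "i \<in> P"]) blast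
    next
      case (3 x)
      then show ?thesis using Q(3)[of x] by auto
    qed auto
  qed
qed

lemma partition_on_h_part:
  assumes "1 \<le> i" "i < j" "j \<le> n"
  shows "partition_on (verts n) (h_part n i j)"
proof (rule partition_onI)
  have "x \<in> verts n" if "x \<in> C" "C \<in> h_part n i j" for x C
    using that assms by (auto simp: h_part_def verts_def)
  moreover have "x \<in> \<Union> (h_part n i j)" if "x \<in> verts n" for x
  proof -
    have "Up y \<in> \<Union> (h_part n i j) \<and> Dn y \<in> \<Union> (h_part n i j)" if "y \<in> {1..n}" for y
    proof -
      consider "y < i \<or> j < y" | "y = i \<or> y = j" | "i < y" "y < j" by linarith
      then show ?thesis
      proof cases
        case 1
        then have "{Up y, Dn y} \<in> h_part n i j" using that unfolding h_part_def by blast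
        then show ?thesis by blast
      next
        case 2
        then show ?thesis using assms by (auto simp: h_part_def)
      next
        case 3
        then have "{Dn y} \<in> h_part n i j" "Up ` {i..j} \<union> {Dn i, Dn j} \<in> h_part n i j"
          unfolding h_part_def by blast+
        moreover have "Up y \<in> Up ` {i..j}" using 3 by simp
        ultimately show ?thesis by blast
      qed
    qed
    then show ?thesis using that by (auto simp: verts_def)
  qed
  ultimately show "\<Union> (h_part n i j) = verts n" by blast
next
  fix C D assume CD: "C \<in> h_part n i j" "D \<in> h_part n i j" "C \<noteq> D"
  have cases: "C = Up ` {i..j} \<union> {Dn i, Dn j} \<or> (\<exists>x. C = {Dn x} \<and> i < x \<and> x < j) \<or>
    (\<exists>x. C = {Up x, Dn x} \<and> (x < i \<or> j < x))" if "C \<in> h_part n i j" for C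
    using that unfolding h_part_def by blast
  from cases[OF CD(1)] cases[OF CD(2)] CD(3) show "disjnt C D"
    using assms(2) by (elim disjE exE conjE) (simp_all add: disjnt_def, auto)
qed (auto simp: h_part_def)

lemma partition_on_one: "partition_on (verts n) (\<one>\<^bsub>partition_monoid n\<^esub>)"
proof (rule partition_onI)
  have "x \<in> \<Union> (\<one>\<^bsub>partition_monoid n\<^esub>)" if x: "x \<in> verts n" for x
  proof -
    obtain y where y: "y \<in> {1..n}" "x \<in> {Up y, Dn y}"
      using x unfolding verts_def by blast
    then have "{Up y, Dn y} \<in> \<one>\<^bsub>partition_monoid n\<^esub>"
      by (auto simp: partition_monoid_def)
    then show ?thesis using y by blast
  qed
  then show "\<Union> (\<one>\<^bsub>partition_monoid n\<^esub>) = verts n"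
    by (auto simp: partition_monoid_def verts_def)
qed (auto simp: partition_monoid_def disjnt_def)

lemma labels_one: "labels n (\<one>\<^bsub>partition_monoid n\<^esub>) = Id_on (Pow {1..n})"
proof (intro equalityI subrelI)
  fix P Q assume PQ: "(P, Q) \<in> labels n (\<one>\<^bsub>partition_monoid n\<^esub>)"
  have "x \<in> P \<longleftrightarrow> x \<in> Q" if "x \<in> {1..n}" for x
  proof -
    have "{Up x, Dn x} \<in> \<one>\<^bsub>partition_monoid n\<^esub>"
      using that by (auto simp: partition_monoid_def)
    from labelsD[OF PQ this, of "Up x" "Dn x"] show ?thesis by simp
  qed
  then have "P = Q" using labels_subset[OF PQ] by blast
  then show "(P, Q) \<in> Id_on (Pow {1..n})"
    using labels_subset[OF PQ] by auto
next
  fix P Q assume "(P, Q) \<in> Id_on (Pow {1..n})"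
  then have P: "P = Q" "P \<subseteq> {1..n}" by auto
  show "(P, Q) \<in> labels n (\<one>\<^bsub>partition_monoid n\<^esub>)"
  proof (rule labelsI_value)
    fix C assume "C \<in> \<one>\<^bsub>partition_monoid n\<^esub>"
    then obtain x where "C = {Up x, Dn x}" by (auto simp: partition_monoid_def)
    then show "\<exists>v. \<forall>x \<in> C. label P Q x \<longleftrightarrow> v" using P(1) by simp
  qed (use P in auto)
qed

section \<open>Compositions of the relations of the generators\<close>

lemma h_labels_O_Id [simp]: "h_labels n i j O Id_on (Pow {1..n}) = h_labels n i j"
  by (auto simp: h_labels_def)

text \<open>As \<open>P\<close> is constant on \<open>{i..j}\<close>, the conditions on
  \<open>Q\<close> at \<open>i\<close> and \<open>j\<close> become agreement with \<open>P\<close>.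
  The end points thus join the outside region and later arguments need no separate cases for
  them.\<close>

lemma h_labelsD:
  assumes "(P, Q) \<in> h_labels n i j"
  shows "P \<subseteq> {1..n}" "Q \<subseteq> {1..n}" "\<And>x. i \<le> x \<Longrightarrow> x \<le> j \<Longrightarrow> x \<in> P \<longleftrightarrow> i \<in> P"
    "\<And>x. x \<le> i \<or> j \<le> x \<Longrightarrow> i \<le> j \<Longrightarrow> x \<in> Q \<longleftrightarrow> x \<in> P"
proof -
  note h = assms[unfolded h_labels_def, simplified]
  show "P \<subseteq> {1..n}" "Q \<subseteq> {1..n}" using h by auto
  show "x \<in> P \<longleftrightarrow> i \<in> P" if "i \<le> x" "x \<le> j" for x
    using h that by (cases "x = i") auto
  show "x \<in> Q \<longleftrightarrow> x \<in> P" if "x \<le> i \<or> j \<le> x" "i \<le> j" for x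
    using h that by (cases "x = i"; cases "x = j") auto
qed

lemma h_labelsI:
  assumes "P \<subseteq> {1..n}" "Q \<subseteq> {1..n}" "i \<le> j"
    "\<And>x. i \<le> x \<Longrightarrow> x \<le> j \<Longrightarrow> x \<in> P \<longleftrightarrow> i \<in> P"
    "\<And>x. x \<le> i \<or> j \<le> x \<Longrightarrow> x \<in> Q \<longleftrightarrow> x \<in> P"
  shows "(P, Q) \<in> h_labels n i j"
proof -
  have "\<forall>x. i < x \<and> x \<le> j \<longrightarrow> (x \<in> P \<longleftrightarrow> i \<in> P)"
    by (intro allI impI assms(4)) simp_all
  moreover have "\<forall>x. x < i \<or> j < x \<longrightarrow> (x \<in> Q \<longleftrightarrow> x \<in> P)"
    by (intro allI impI assms(5)) auto
  moreover have "i \<in> Q \<longleftrightarrow> i \<in> P" "j \<in> Q \<longleftrightarrow> i \<in> P"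
    using assms(4)[of j] assms(5)[of i] assms(5)[of j] assms(3) by simp_all
  ultimately show ?thesis unfolding h_labels_def using assms(1,2) by blast
qed

text \<open>\<open>M\<close> is constant on \<open>{k..l}\<close> and agrees with \<open>P\<close>
  off the open interval from \<open>i\<close> to \<open>j\<close>, in particular at
  \<open>i\<close>. The constancy of \<open>P\<close> on \<open>{i..j}\<close> carries the value
  through, so \<open>P\<close> already satisfies what the wider letter asks.\<close>

lemma h_labels_absorb:
  assumes "k \<le> i" "i < j" "j \<le> l"
  shows "h_labels n i j O h_labels n k l = h_labels n k l"
proof (intro equalityI subrelI)
  fix P Q assume "(P, Q) \<in> h_labels n i j O h_labels n k l"
  then obtain M where PM: "(P, M) \<in> h_labels n i j" and MQ: "(M, Q) \<in> h_labels n k l" by blast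
  note PM = h_labelsD[OF PM] and MQ = h_labelsD[OF MQ]
  have "x \<in> P \<longleftrightarrow> k \<in> P" if "k \<le> x" "x \<le> l" for x
  proof (cases "x \<le> i \<or> j \<le> x")
    case True
    then show ?thesis using PM(4)[of x] PM(4)[of k] MQ(3)[of x] that assms by simp
  next
    case False
    then show ?thesis
      using PM(3)[of x] PM(4)[of i] PM(4)[of k] MQ(3)[of i] that assms by simp
  qed
  moreover have "x \<in> Q \<longleftrightarrow> x \<in> P" if "x \<le> k \<or> l \<le> x" for x
  proof -
    have "x \<le> i \<or> j \<le> x" using that assms by linarith
    then show ?thesis using MQ(4)[of x] PM(4)[of x] that assms by simp
  qed
  moreover have "k \<le> l" using assms by simp
  ultimately show "(P, Q) \<in> h_labels n k l"
    by (intro h_labelsI PM(1) MQ(2))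
next
  fix P Q assume PQ: "(P, Q) \<in> h_labels n k l"
  note PQ' = h_labelsD[OF PQ]
  have "x \<in> P \<longleftrightarrow> i \<in> P" if "i \<le> x" "x \<le> j" for x
    using PQ'(3)[of x] PQ'(3)[of i] that assms by simp
  moreover have "i \<le> j" using assms by simp
  \<comment> \<open>The first letter may leave the upper labels as they are: the middle labelling is
    \<open>P\<close> itself.\<close>
  ultimately have "(P, P) \<in> h_labels n i j"
    by (intro h_labelsI PQ'(1) refl)
  then show "(P, Q) \<in> h_labels n i j O h_labels n k l" using PQ by blast
qed

text \<open>Symmetric in the two intervals, hence suited to both sides of the commutation relation;
  for adjacent intervals it is also the common value of the three products in the last family of
  relations. A shared end point is in neither open interval and keeps its label.\<close>

definition join_labels :: "nat \<Rightarrow> nat \<Rightarrow> nat \<Rightarrow> nat \<Rightarrow> nat \<Rightarrow> (nat set \<times> nat set) set" where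
  "join_labels n i j k l = {(P, Q). P \<subseteq> {1..n} \<and> Q \<subseteq> {1..n} \<and>
     (\<forall>x. i < x \<and> x \<le> j \<longrightarrow> (x \<in> P \<longleftrightarrow> i \<in> P)) \<and>
     (\<forall>x. k < x \<and> x \<le> l \<longrightarrow> (x \<in> P \<longleftrightarrow> k \<in> P)) \<and>
     (\<forall>x. \<not> (i < x \<and> x < j) \<and> \<not> (k < x \<and> x < l) \<longrightarrow> (x \<in> Q \<longleftrightarrow> x \<in> P))}"

lemma join_labelsD:
  assumes "(P, Q) \<in> join_labels n i j k l"
  shows "P \<subseteq> {1..n}" "Q \<subseteq> {1..n}" "\<And>x. i \<le> x \<Longrightarrow> x \<le> j \<Longrightarrow> x \<in> P \<longleftrightarrow> i \<in> P"
    "\<And>x. k \<le> x \<Longrightarrow> x \<le> l \<Longrightarrow> x \<in> P \<longleftrightarrow> k \<in> P"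
    "\<And>x. x \<le> i \<or> j \<le> x \<Longrightarrow> x \<le> k \<or> l \<le> x \<Longrightarrow> x \<in> Q \<longleftrightarrow> x \<in> P"
proof -
  note h = assms[unfolded join_labels_def mem_Collect_eq prod.case]
  show "P \<subseteq> {1..n}" "Q \<subseteq> {1..n}" using h by blast+
  show "x \<in> P \<longleftrightarrow> i \<in> P" if "i \<le> x" "x \<le> j" for x
    using h that le_neq_implies_less by blast
  show "x \<in> P \<longleftrightarrow> k \<in> P" if "k \<le> x" "x \<le> l" for x
    using h that le_neq_implies_less by blast
  show "x \<in> Q \<longleftrightarrow> x \<in> P" if "x \<le> i \<or> j \<le> x" "x \<le> k \<or> l \<le> x" for x
    using h that not_less by blast
qed

lemma join_labelsI:
  assumes "P \<subseteq> {1..n}" "Q \<subseteq> {1..n}"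
    "\<And>x. i \<le> x \<Longrightarrow> x \<le> j \<Longrightarrow> x \<in> P \<longleftrightarrow> i \<in> P"
    "\<And>x. k \<le> x \<Longrightarrow> x \<le> l \<Longrightarrow> x \<in> P \<longleftrightarrow> k \<in> P"
    "\<And>x. x \<le> i \<or> j \<le> x \<Longrightarrow> x \<le> k \<or> l \<le> x \<Longrightarrow> x \<in> Q \<longleftrightarrow> x \<in> P"
  shows "(P, Q) \<in> join_labels n i j k l"
proof -
  have "\<forall>x. i < x \<and> x \<le> j \<longrightarrow> (x \<in> P \<longleftrightarrow> i \<in> P)" "\<forall>x. k < x \<and> x \<le> l \<longrightarrow> (x \<in> P \<longleftrightarrow> k \<in> P)"
    by (intro allI impI assms(3) assms(4); simp)+
  moreover have "\<forall>x. \<not> (i < x \<and> x < j) \<and> \<not> (k < x \<and> x < l) \<longrightarrow> (x \<in> Q \<longleftrightarrow> x \<in> P)"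
    by (intro allI impI assms(5)) auto
  ultimately show ?thesis unfolding join_labels_def using assms(1,2) by blast
qed

lemma join_labels_commute: "join_labels n i j k l = join_labels n k l i j"
proof -
  have "join_labels n i j k l \<subseteq> join_labels n k l i j" for i j k l
  proof (rule subrelI)
    fix P Q assume "(P, Q) \<in> join_labels n i j k l"
    note PQ = join_labelsD[OF this]
    show "(P, Q) \<in> join_labels n k l i j"
      by (rule join_labelsI[OF PQ(1,2,4,3,5)])
  qed
  then show ?thesis by blast
qed

lemma h_labels_disjoint:
  assumes "i < j" "k < l" "j \<le> k \<or> l \<le> i"
  shows "h_labels n i j O h_labels n k l = join_labels n i j k l"
proof (intro equalityI subrelI)
  fix P Q assume "(P, Q) \<in> h_labels n i j O h_labels n k l"
  then obtain M where PM: "(P, M) \<in> h_labels n i j" and MQ: "(M, Q) \<in> h_labels n k l" by blast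
  note PM = h_labelsD[OF PM] and MQ = h_labelsD[OF MQ]
  show "(P, Q) \<in> join_labels n i j k l"
  proof (rule join_labelsI[OF PM(1) MQ(2) PM(3)])
    show "x \<in> P \<longleftrightarrow> k \<in> P" if "k \<le> x" "x \<le> l" for x
      using PM(4)[of x] PM(4)[of k] MQ(3)[of x] that assms by auto
    show "x \<in> Q \<longleftrightarrow> x \<in> P" if "x \<le> i \<or> j \<le> x" "x \<le> k \<or> l \<le> x" for x
      using PM(4)[of x] MQ(4)[of x] that assms by auto
  qed
next
  fix P Q assume "(P, Q) \<in> join_labels n i j k l"
  note PQ = join_labelsD[OF this]
  \<comment> \<open>The second letter passes on the labels in the open interval from
    \<open>i\<close> to \<open>j\<close>, so those of \<open>Q\<close> must already be introduced by
    the first.\<close>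
  define M where "M = (P - {i<..<j}) \<union> (Q \<inter> {i<..<j})"
  have M: "x \<in> M \<longleftrightarrow> (if i < x \<and> x < j then x \<in> Q else x \<in> P)" for x
    by (auto simp: M_def)
  have "M \<subseteq> {1..n}" using PQ(1,2) by (auto simp: M_def)
  have "(P, M) \<in> h_labels n i j"
  proof (rule h_labelsI[OF PQ(1) \<open>M \<subseteq> {1..n}\<close> _ PQ(3)])
    show "x \<in> M \<longleftrightarrow> x \<in> P" if "x \<le> i \<or> j \<le> x" for x
      using M[of x] that by auto
  qed (use assms in simp)
  moreover have "(M, Q) \<in> h_labels n k l"
  proof (rule h_labelsI[OF \<open>M \<subseteq> {1..n}\<close> PQ(2)])
    show "x \<in> M \<longleftrightarrow> k \<in> M" if "k \<le> x" "x \<le> l" for x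
      using PQ(4)[of x] M[of x] M[of k] that assms by auto
    show "x \<in> Q \<longleftrightarrow> x \<in> M" if "x \<le> k \<or> l \<le> x" for x
      using PQ(5)[of x] M[of x] that assms by auto
  qed (use assms in simp)
  ultimately show "(P, Q) \<in> h_labels n i j O h_labels n k l" by blast
qed

text \<open>The letter \<open>H i k\<close> forgets the label at \<open>j\<close>, but the second
  letter forces \<open>M\<close> to be constant on an interval joining \<open>j\<close> to
  \<open>i\<close> or to \<open>k\<close>, where \<open>M\<close> still agrees with
  \<open>P\<close>; so the label at \<open>j\<close> comes back. The other labels strictly between
  \<open>i\<close> and \<open>k\<close> are freed by one letter or the other.\<close>

lemma h_labels_split:
  assumes "i < j" "j < k" and ab: "(a, b) = (i, j) \<or> (a, b) = (j, k)"
  shows "h_labels n i k O h_labels n a b = join_labels n i j j k"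
proof (intro equalityI subrelI)
  fix P Q assume "(P, Q) \<in> h_labels n i k O h_labels n a b"
  then obtain M where PM: "(P, M) \<in> h_labels n i k" and MQ: "(M, Q) \<in> h_labels n a b" by blast
  note PM = h_labelsD[OF PM] and MQ = h_labelsD[OF MQ]
  show "(P, Q) \<in> join_labels n i j j k"
  proof (rule join_labelsI[OF PM(1) MQ(2)])
    have iP: "x \<in> P \<longleftrightarrow> i \<in> P" if "i \<le> x" "x \<le> k" for x
      using that by (rule PM(3))
    show "x \<in> P \<longleftrightarrow> i \<in> P" if "i \<le> x" "x \<le> j" for x
      using that assms by (intro iP) auto
    show "x \<in> P \<longleftrightarrow> j \<in> P" if "j \<le> x" "x \<le> k" for x
      using that assms iP[of x] iP[of j] by linarith
    have "i \<in> M \<longleftrightarrow> i \<in> P" "k \<in> M \<longleftrightarrow> i \<in> P" "j \<in> P \<longleftrightarrow> i \<in> P"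
      using PM(4)[of i] PM(4)[of k] iP[of j] iP[of k] assms(1,2) by simp_all
    moreover have "j \<in> M \<longleftrightarrow> i \<in> M" if "a = i" "b = j"
      using MQ(3)[of j] that assms(1) by simp
    moreover have "k \<in> M \<longleftrightarrow> j \<in> M" if "a = j" "b = k"
      using MQ(3)[of k] that assms(2) by simp
    ultimately have "j \<in> M \<longleftrightarrow> j \<in> P"
      using ab by blast
    moreover have "j \<in> Q \<longleftrightarrow> j \<in> M"
      using MQ(4)[of j] assms by auto
    ultimately show "x \<in> Q \<longleftrightarrow> x \<in> P" if "x \<le> i \<or> j \<le> x" "x \<le> j \<or> k \<le> x" for x
    proof (cases "x = j")
      case False
      then have "x \<le> i \<or> k \<le> x" using that by auto
      moreover from this have "x \<le> a \<or> b \<le> x" "a \<le> b" "i \<le> k" using assms by auto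
      ultimately show ?thesis using PM(4)[of x] MQ(4)[of x] by simp
    qed simp
  qed
next
  fix P Q assume "(P, Q) \<in> join_labels n i j j k"
  note PQ = join_labelsD[OF this]
  \<comment> \<open>Interior labels that the second letter does not free must already be those of
    \<open>Q\<close>. This prescribes \<open>Q\<close> at \<open>j\<close> as well, consistently,
    because \<open>Q\<close> and \<open>P\<close> agree there.\<close>
  define M where "M = (P - ({i<..<k} - {a<..<b})) \<union> (Q \<inter> ({i<..<k} - {a<..<b}))"
  have M: "x \<in> M \<longleftrightarrow> (if i < x \<and> x < k \<and> \<not> (a < x \<and> x < b) then x \<in> Q else x \<in> P)" for x
    by (auto simp: M_def)
  have "M \<subseteq> {1..n}" using PQ(1,2) unfolding M_def by blast
  have iP: "x \<in> P \<longleftrightarrow> i \<in> P" if "i \<le> x" "x \<le> k" for x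
    using PQ(3)[of x] PQ(4)[of x] PQ(3)[of j] that assms(1,2) by linarith
  have jM: "j \<in> M \<longleftrightarrow> j \<in> P" using M[of j] PQ(5)[of j] by auto
  have "(P, M) \<in> h_labels n i k"
  proof (rule h_labelsI[OF PQ(1) \<open>M \<subseteq> {1..n}\<close>])
    show "x \<in> P \<longleftrightarrow> i \<in> P" if "i \<le> x" "x \<le> k" for x
      using that by (rule iP)
    show "x \<in> M \<longleftrightarrow> x \<in> P" if "x \<le> i \<or> k \<le> x" for x
      using M[of x] that by auto
  qed (use assms in simp)
  moreover have "(M, Q) \<in> h_labels n a b"
  proof (rule h_labelsI[OF \<open>M \<subseteq> {1..n}\<close> PQ(2)])
    have MP: "x \<in> M \<longleftrightarrow> i \<in> P" if "a \<le> x" "x \<le> b" for x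
    proof -
      have "x \<in> M \<longleftrightarrow> x \<in> P"
      proof (cases "x = j")
        case False
        then have "\<not> (i < x \<and> x < k) \<or> (a < x \<and> x < b)" using ab that by auto
        then show ?thesis using M[of x] by auto
      qed (use jM in simp)
      moreover have "i \<le> x" "x \<le> k" using ab that assms(1,2) by auto
      ultimately show ?thesis using iP[of x] by blast
    qed
    show "x \<in> M \<longleftrightarrow> a \<in> M" if "a \<le> x" "x \<le> b" for x
      using MP[of x] MP[of a] that by linarith
    show "x \<in> Q \<longleftrightarrow> x \<in> M" if "x \<le> a \<or> b \<le> x" for x
    proof -
      have "x \<in> Q \<longleftrightarrow> x \<in> P" if "x \<le> i \<or> k \<le> x"
        using that assms(1,2) by (intro PQ(5)) auto
      then show ?thesis using M[of x] that by (cases "i < x \<and> x < k") auto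
    qed
  qed (use assms ab in auto)
  ultimately show "(P, Q) \<in> h_labels n i k O h_labels n a b" by blast
qed

section \<open>Rewriting words to normal form\<close>

text \<open>What lets the arc from \<open>k\<close> to \<open>m\<close> be put in front of
  \<open>w\<close>: no arc crosses it, and none starting before \<open>m\<close> ends at
  \<open>m\<close>, since then \<open>k\<close> and \<open>m\<close> would not be consecutive in
  their class. An arc may start at \<open>m\<close>. For \<open>m = 0\<close> only the condition on
  left ends remains.\<close>

definition clear :: "nat \<Rightarrow> nat \<Rightarrow> letter list \<Rightarrow> bool" where
  "clear k m w \<longleftrightarrow> (\<forall>c d. H c d \<in> set w \<longrightarrow> k < c \<and> (m \<le> c \<or> d < m))"

fun normal :: "letter list \<Rightarrow> bool" where
  "normal [] \<longleftrightarrow> True"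
| "normal (H a b # w) \<longleftrightarrow> clear a b w \<and> normal w"

lemma clear_Nil [simp]: "clear k m []"
  by (simp add: clear_def)

lemma clear_Cons [simp]:
  "clear k m (H a b # w) \<longleftrightarrow> k < a \<and> (m \<le> a \<or> b < m) \<and> clear k m w"
  by (auto simp: clear_def)

lemma H_in_X_D [simp]: "H i j \<in> X_D n \<longleftrightarrow> 1 \<le> i \<and> i < j \<and> j \<le> n"
  by (auto simp: X_D_def)

section \<open>The congruence generated by the relations\<close>

definition word_cong :: "nat \<Rightarrow> (letter list \<times> letter list) set" where
  "word_cong n = congruence_generated (free_monoid (X_D n)) (R_D n)"

lemma congruence_generated_props:
  assumes "monoid M" "R \<subseteq> carrier M \<times> carrier M"
  shows "is_congruence M (congruence_generated M R)" "R \<subseteq> congruence_generated M R"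
    "\<And>r. is_congruence M r \<Longrightarrow> R \<subseteq> r \<Longrightarrow> congruence_generated M R \<subseteq> r"
proof -
  have top: "is_congruence M (carrier M \<times> carrier M)"
    using monoid.m_closed[OF assms(1)]
    by (auto simp: is_congruence_def equiv_def refl_on_def sym_def trans_def)
  show "is_congruence M (congruence_generated M R)"
    unfolding is_congruence_def
  proof (intro conjI equivI allI impI)
    show "congruence_generated M R \<subseteq> carrier M \<times> carrier M"
      using top assms unfolding congruence_generated_def by blast
    show "refl_on (carrier M) (congruence_generated M R)"
      unfolding congruence_generated_def refl_on_def
      by (auto simp: is_congruence_def equiv_def refl_on_def)
    show "sym (congruence_generated M R)"
      unfolding congruence_generated_def
      by (rule symI) (auto simp: is_congruence_def equiv_def dest: symD)
    show "trans (congruence_generated M R)"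
      unfolding congruence_generated_def
      by (rule transI) (auto simp: is_congruence_def equiv_def dest: transD)
    show "(a \<otimes>\<^bsub>M\<^esub> c, b \<otimes>\<^bsub>M\<^esub> d) \<in> congruence_generated M R"
      if "(a, b) \<in> congruence_generated M R" "(c, d) \<in> congruence_generated M R" for a b c d
      using that unfolding congruence_generated_def is_congruence_def by auto
  qed
qed (auto simp: congruence_generated_def)

lemma monoid_free_monoid: "monoid (free_monoid X)"
  by unfold_locales (auto simp: free_monoid_def)

lemma R_D_subset: "R_D n \<subseteq> lists (X_D n) \<times> lists (X_D n)"
  by (auto simp: R_D_def)

lemma word_cong:
  shows is_congruence_word_cong: "is_congruence (free_monoid (X_D n)) (word_cong n)"
    and R_D_subset_word_cong: "R_D n \<subseteq> word_cong n"
    and word_cong_least: "is_congruence (free_monoid (X_D n)) r \<Longrightarrow> R_D n \<subseteq> r \<Longrightarrow> word_cong n \<subseteq> r"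
  using congruence_generated_props[OF monoid_free_monoid, of "R_D n" "X_D n"] R_D_subset[of n]
  by (auto simp: word_cong_def free_monoid_def)

lemma word_cong_lists: "(u, v) \<in> word_cong n \<Longrightarrow> u \<in> lists (X_D n) \<and> v \<in> lists (X_D n)"
  using is_congruence_word_cong[of n] unfolding is_congruence_def equiv_def
  by (auto simp: free_monoid_def)

lemma word_cong_refl: "w \<in> lists (X_D n) \<Longrightarrow> (w, w) \<in> word_cong n"
  using is_congruence_word_cong[of n] unfolding is_congruence_def equiv_def
  by (auto simp: free_monoid_def refl_on_def)

lemma word_cong_sym: "(u, v) \<in> word_cong n \<Longrightarrow> (v, u) \<in> word_cong n"
  using is_congruence_word_cong[of n] unfolding is_congruence_def equiv_def
  by (auto dest: symD)

lemma word_cong_trans [trans]: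
  "(u, v) \<in> word_cong n \<Longrightarrow> (v, w) \<in> word_cong n \<Longrightarrow> (u, w) \<in> word_cong n"
  using is_congruence_word_cong[of n] unfolding is_congruence_def equiv_def
  by (auto dest: transD)

lemma word_cong_append:
  "(u, v) \<in> word_cong n \<Longrightarrow> (u', v') \<in> word_cong n \<Longrightarrow> (u @ u', v @ v') \<in> word_cong n"
  using is_congruence_word_cong[of n] unfolding is_congruence_def
  by (auto simp: free_monoid_def)

lemma word_cong_Cons:
  "x \<in> X_D n \<Longrightarrow> (u, v) \<in> word_cong n \<Longrightarrow> (x # u, x # v) \<in> word_cong n"
  using word_cong_append[OF word_cong_refl[of "[x]"]] by simp

lemma word_cong_R_D:
  "(u, v) \<in> R_D n \<Longrightarrow> w \<in> lists (X_D n) \<Longrightarrow> (u @ w, v @ w) \<in> word_cong n"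
  using R_D_subset_word_cong by (blast intro: word_cong_append word_cong_refl)

section \<open>The relations as rewriting steps in front of a word\<close>

lemma absorb:
  assumes "1 \<le> k" "k \<le> i" "i < j" "j \<le> l" "l \<le> n" "w \<in> lists (X_D n)"
  shows "(H i j # H k l # w, H k l # w) \<in> word_cong n"
proof -
  have "([H i j, H k l], [H k l]) \<in> R_D n"
    using assms unfolding R_D_def by auto
  from word_cong_R_D[OF this assms(6)] show ?thesis by simp
qed

lemma commute:
  assumes "1 \<le> i" "i < j" "j \<le> k" "k < l" "l \<le> n" "w \<in> lists (X_D n)"
  shows "(H i j # H k l # w, H k l # H i j # w) \<in> word_cong n"
proof -
  have "([H i j, H k l], [H k l, H i j]) \<in> R_D n"
    using assms unfolding R_D_def by auto
  from word_cong_R_D[OF this assms(6)] show ?thesis by simp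
qed

lemma split:
  assumes "1 \<le> i" "i < j" "j < k" "k \<le> n" "w \<in> lists (X_D n)"
  shows split_left: "(H i k # H i j # w, H i j # H j k # w) \<in> word_cong n"
    and split_right: "(H i k # H j k # w, H i j # H j k # w) \<in> word_cong n"
proof -
  have "([H i j, H j k], [H i k, H i j]) \<in> R_D n" "([H i k, H i j], [H i k, H j k]) \<in> R_D n"
    using assms unfolding R_D_def by auto
  from this[THEN word_cong_R_D[OF _ assms(5)]]
  have *: "(H i j # H j k # w, H i k # H i j # w) \<in> word_cong n"
    "(H i k # H i j # w, H i k # H j k # w) \<in> word_cong n"
    by simp_all
  show "(H i k # H i j # w, H i j # H j k # w) \<in> word_cong n"
    using * word_cong_sym by blast
  show "(H i k # H j k # w, H i j # H j k # w) \<in> word_cong n"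
    using * word_cong_sym word_cong_trans by meson
qed

text \<open>The letter commutes past every arc ending at or before \<open>c\<close> and is absorbed
  by the first arc that does not: by \<open>clear\<close>, that arc is \<open>H c d\<close> or
  covers it.\<close>

lemma absorb_member:
  assumes "normal w" "w \<in> lists (X_D n)" "H c d \<in> set w" "c \<le> x" "x < y" "y \<le> d"
  shows "(H x y # w, w) \<in> word_cong n"
  using assms
proof (induction w rule: normal.induct)
  case (2 a b w)
  then have X: "1 \<le> a" "a < b" "b \<le> n" "w \<in> lists (X_D n)" by auto
  show ?case
  proof (cases "H c d = H a b")
    case True
    then show ?thesis using X 2 by (intro absorb) auto
  next
    case False
    then have w: "H c d \<in> set w" using 2 by auto
    then have cd: "a < c" "b \<le> c \<or> d < b" "H c d \<in> X_D n"
      using 2 by (auto simp: clear_def)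
    show ?thesis
    proof (cases "b \<le> c")
      case True
      have "(H x y # H a b # w, H a b # H x y # w) \<in> word_cong n"
        using X cd 2 True by (intro word_cong_sym[OF commute]) auto
      also have "(H a b # H x y # w, H a b # w) \<in> word_cong n"
        using X w 2 by (intro word_cong_Cons "2.IH") auto
      finally show ?thesis .
    next
      case False
      then show ?thesis using X cd 2 by (intro absorb) auto
    qed
  qed
qed simp

text \<open>An arc \<open>H c d\<close> of \<open>w\<close> with \<open>c < j \<le> d\<close> lets us replace \<open>H i j\<close> by \<open>H i c\<close>:
  insert the absorbed letter \<open>H c j\<close>, split, and absorb it again.\<close>

lemma insert_left:
  assumes "normal w" "w \<in> lists (X_D n)" "1 \<le> i" "i < j" "j \<le> n" "clear i 0 w"
  shows "\<exists>b. i < b \<and> b \<le> n \<and> normal (H i b # w) \<and> (H i j # w, H i b # w) \<in> word_cong n"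
  using assms(4,5)
proof (induction j rule: less_induct)
  case (less j)
  have Hij: "H i j \<in> X_D n" using less assms by simp
  show ?case
  proof (cases "clear i j w")
    case True
    then show ?thesis using assms less Hij
      by (intro exI[of _ j]) (auto intro!: word_cong_refl)
  next
    case False
    then obtain c d where cd: "H c d \<in> set w" "c < j" "j \<le> d" "i < c"
      using assms(6) by (force simp: clear_def)
    have abs: "(H c j # w, w) \<in> word_cong n"
      using assms cd by (intro absorb_member) auto
    have "(H i j # w, H i j # H c j # w) \<in> word_cong n"
      by (rule word_cong_Cons[OF Hij word_cong_sym[OF abs]])
    also have "(H i j # H c j # w, H i c # H c j # w) \<in> word_cong n"
      using assms less cd by (intro split_right) auto
    also have "(H i c # H c j # w, H i c # w) \<in> word_cong n"
      using assms less cd abs by (intro word_cong_Cons) auto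
    finally have "(H i j # w, H i c # w) \<in> word_cong n" .
    moreover obtain b where "i < b" "b \<le> n" "normal (H i b # w)" "(H i c # w, H i b # w) \<in> word_cong n"
      using less.IH[of c] less.prems cd by auto
    ultimately show ?thesis using word_cong_trans by blast
  qed
qed

text \<open>Uncrossing: \<open>H a b\<close> emits the letter \<open>H i b\<close>, which it can
  absorb; with its help \<open>H i j\<close> splits into \<open>H i b\<close> and
  \<open>H b j\<close>; then \<open>H b j\<close> moves past \<open>H a b\<close>, which absorbs
  \<open>H i b\<close> again.\<close>

lemma overlap:
  assumes "1 \<le> a" "a \<le> i" "i < b" "b < j" "j \<le> n" and w: "w \<in> lists (X_D n)"
  shows "(H i j # H a b # w, H a b # H b j # w) \<in> word_cong n"
proof (cases "i = a")
  case True
  then show ?thesis using split_left[of a b j n w] assms by simp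
next
  case False
  have "(H i j # H a b # w, H i j # H i b # H a b # w) \<in> word_cong n"
    using assms by (intro word_cong_Cons word_cong_sym[OF absorb]) auto
  also have "(H i j # H i b # H a b # w, H i b # H b j # H a b # w) \<in> word_cong n"
    using assms by (intro split_left) auto
  also have "(H i b # H b j # H a b # w, H i b # H a b # H b j # w) \<in> word_cong n"
    using assms by (intro word_cong_Cons word_cong_sym[OF commute]) auto
  also have "(H i b # H a b # H b j # w, H a b # H b j # w) \<in> word_cong n"
    using assms by (intro absorb) auto
  finally show ?thesis .
qed

text \<open>The clause on \<open>clear\<close> strengthens the induction: if the front arc
  \<open>H a b\<close> stays, the rewritten tail must still be clear for it. It is used with
  \<open>k = a\<close> and \<open>m = b\<close>; when the arc passed to the tail starts exactly at
  \<open>b\<close>, the bound on \<open>m\<close> is attained.\<close>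

lemma insert_letter:
  assumes "normal w" "w \<in> lists (X_D n)" "1 \<le> i" "i < j" "j \<le> n"
  shows "\<exists>w'. normal w' \<and> (H i j # w, w') \<in> word_cong n \<and>
    (\<forall>k m. k < i \<longrightarrow> m \<le> i \<longrightarrow> clear k m w \<longrightarrow> clear k m w')"
  using assms
proof (induction w arbitrary: i j rule: normal.induct)
  case 1
  then show ?case by (intro exI[of _ "[H i j]"]) (auto intro!: word_cong_refl)
next
  case (2 a b w)
  then have X: "1 \<le> a" "a < b" "b \<le> n" "w \<in> lists (X_D n)"
    and N: "clear a b w" "normal w" by auto
  \<comment> \<open>Relative to the front arc, the new one starts earlier, lies under it, starts at
    or after its right end, or straddles that end.\<close>
  consider "i < a" | "a \<le> i" "j \<le> b" | "b \<le> i" | "a \<le> i" "i < b" "b < j" by linarith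
  then show ?case
  proof cases
    case 1
    then have "clear i 0 (H a b # w)" using N by (fastforce simp: clear_def)
    then obtain c where c: "i < c" "normal (H i c # H a b # w)"
      "(H i j # H a b # w, H i c # H a b # w) \<in> word_cong n"
      using insert_left[OF "2.prems"] by blast
    then show ?thesis by (intro exI[of _ "H i c # H a b # w"]) auto
  next
    case 2
    then have "(H i j # H a b # w, H a b # w) \<in> word_cong n"
      using X "2.prems" by (intro absorb) auto
    then show ?thesis using "2.prems" by blast
  next
    case 3
    obtain w' where w': "normal w'" "(H i j # w, w') \<in> word_cong n"
      "\<And>k m. k < i \<Longrightarrow> m \<le> i \<Longrightarrow> clear k m w \<Longrightarrow> clear k m w'"
      using "2.IH"[of i j] N X "2.prems" by blast
    have "(H i j # H a b # w, H a b # H i j # w) \<in> word_cong n"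
      using X "2.prems" 3 by (intro word_cong_sym[OF commute]) auto
    also have "(H a b # H i j # w, H a b # w') \<in> word_cong n"
      using X w' by (intro word_cong_Cons) auto
    finally show ?thesis
      using w' N X 3 by (intro exI[of _ "H a b # w'"]) auto
  next
    case 4
    obtain w' where w': "normal w'" "(H b j # w, w') \<in> word_cong n"
      "\<And>k m. k < b \<Longrightarrow> m \<le> b \<Longrightarrow> clear k m w \<Longrightarrow> clear k m w'"
      using "2.IH"[of b j] N X "2.prems" 4 by auto
    have "(H i j # H a b # w, H a b # H b j # w) \<in> word_cong n"
      using X "2.prems" 4 by (intro overlap) auto
    also have "(H a b # H b j # w, H a b # w') \<in> word_cong n"
      using X w' by (intro word_cong_Cons) auto
    finally show ?thesis
      using w' N X 4 by (intro exI[of _ "H a b # w'"]) auto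
  qed
qed

lemma normal_form_exists:
  assumes "w \<in> lists (X_D n)"
  shows "\<exists>w'. normal w' \<and> (w, w') \<in> word_cong n"
  using assms
proof (induction w)
  case Nil
  then show ?case by (intro exI[of _ "[]"]) (auto intro!: word_cong_refl)
next
  case (Cons x w)
  then obtain v where v: "normal v" "(w, v) \<in> word_cong n" by auto
  obtain i j where x: "x = H i j" by (cases x)
  have "H i j \<in> X_D n" "v \<in> lists (X_D n)" using Cons x v word_cong_lists by auto
  then obtain w' where w': "normal w'" "(H i j # v, w') \<in> word_cong n"
    using insert_letter[OF v(1), of n i j] by auto
  have "(x # w, H i j # v) \<in> word_cong n"
    unfolding x by (rule word_cong_Cons[OF \<open>H i j \<in> X_D n\<close> v(2)])
  then show ?case using w' word_cong_trans by blast
qed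

section \<open>Planar equivalences are the noncrossing ones\<close>

definition noncrossing :: "(nat \<times> nat) set \<Rightarrow> bool" where
  "noncrossing r \<longleftrightarrow>
     (\<forall>x y z t. x < y \<and> y < z \<and> z < t \<and> (x, z) \<in> r \<and> (y, t) \<in> r \<longrightarrow> (x, y) \<in> r)"

text \<open>Dispenses with the enumeration of \<open>B\<close>: the gap holding \<open>A\<close>
  lies between the last element of \<open>B\<close> before \<open>A\<close> and its
  successor.\<close>

lemma nested_by_iff:
  assumes A: "finite A" "A \<noteq> {}" and B: "finite B"
  shows "nested_by A B \<longleftrightarrow>
    (\<exists>u \<in> B. u < Min A) \<and> (\<exists>v \<in> B. Max A < v) \<and> (\<forall>y \<in> B. y < Min A \<or> Max A < y)"
proof
  define xs where "xs = sorted_list_of_set B"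
  have xs: "sorted xs" "set xs = B" "length xs = card B"
    using B by (auto simp: xs_def)
  {
    assume "nested_by A B"
    then obtain t where t: "Suc t < length xs" "xs ! t < Min A" "Max A < xs ! Suc t"
      unfolding nested_by_def xs_def[symmetric] xs(3)[symmetric] by blast
    have "xs ! t \<in> B" "xs ! Suc t \<in> B"
      using t nth_mem[of _ xs] xs(2) by auto
    moreover have "y < Min A \<or> Max A < y" if y: "y \<in> B" for y
    proof -
      obtain s where s: "s < length xs" "y = xs ! s"
        using y xs(2) by (metis in_set_conv_nth)
      show ?thesis
      proof (cases "s \<le> t")
        case True
        then have "y \<le> xs ! t" using s t sorted_nth_mono[OF xs(1)] by simp
        then show ?thesis using t by simp
      next
        case False
        then have "xs ! Suc t \<le> y" using s sorted_nth_mono[OF xs(1)] by simp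
        then show ?thesis using t by simp
      qed
    qed
    ultimately show "(\<exists>u \<in> B. u < Min A) \<and> (\<exists>v \<in> B. Max A < v) \<and>
        (\<forall>y \<in> B. y < Min A \<or> Max A < y)"
      using t by blast
  }
  {
    assume gap: "(\<exists>u \<in> B. u < Min A) \<and> (\<exists>v \<in> B. Max A < v) \<and>
        (\<forall>y \<in> B. y < Min A \<or> Max A < y)"
    have le: "Min A \<le> Max A" using A by simp
    define T where "T = {s. s < length xs \<and> xs ! s < Min A}"
    define t where "t = Max T"
    have "finite T" by (simp add: T_def)
    moreover have "T \<noteq> {}"
      using gap unfolding T_def xs(2)[symmetric] by (auto simp: in_set_conv_nth)
    ultimately have "t \<in> T" and max: "\<And>s. s \<in> T \<Longrightarrow> s \<le> t"
      unfolding t_def by (auto intro: Max_in)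
    then have t: "t < length xs" "xs ! t < Min A" by (auto simp: T_def)
    obtain s where s: "s < length xs" "Max A < xs ! s"
      using gap xs(2) by (metis in_set_conv_nth)
    have "t < s"
    proof (rule ccontr)
      assume "\<not> t < s"
      then have "xs ! s \<le> xs ! t" using sorted_nth_mono[OF xs(1)] t by simp
      then show False using s t le by simp
    qed
    then have St: "Suc t < length xs" using s by simp
    have "Suc t \<notin> T" using max[of "Suc t"] by auto
    then have "\<not> xs ! Suc t < Min A" using St by (simp add: T_def)
    moreover have "xs ! Suc t \<in> B" using St xs(2) nth_mem by blast
    ultimately have "Max A < xs ! Suc t" using gap by blast
    then show "nested_by A B"
      unfolding nested_by_def xs_def[symmetric] xs(3)[symmetric] using St t le by blast
  }
qed

lemma class_finite:
  assumes "equiv {1..n::nat} r" "C \<in> {1..n} // r"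
  shows "finite C" "C \<noteq> {}" "C \<subseteq> {1..n}"
  using assms in_quotient_imp_subset[OF assms] in_quotient_imp_non_empty[OF assms]
    finite_subset[of C "{1..n}"] by auto

text \<open>If the classes \<open>A\<close> of \<open>x\<close> and \<open>B\<close> of
  \<open>y\<close> were distinct, their ranges would overlap, so they are not separated. Moreover
  \<open>y\<close> lies in the range of \<open>A\<close> and \<open>z\<close> in that of
  \<open>B\<close>, so neither class fits into a gap of the other.\<close>

lemma planar_imp_noncrossing:
  assumes "planar n r"
  shows "noncrossing r"
proof -
  have eq: "equiv {1..n} r" using assms by (simp add: planar_def)
  have "(x, y) \<in> r" if *: "x < y" "y < z" "z < t" "(x, z) \<in> r" "(y, t) \<in> r" for x y z t
  proof (rule ccontr)
    assume xy: "(x, y) \<notin> r"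
    define A B where "A = r `` {x}" and "B = r `` {y}"
    have xyn: "x \<in> {1..n}" "y \<in> {1..n}" using eq * by (auto simp: equiv_def)
    then have AB: "A \<in> {1..n} // r" "B \<in> {1..n} // r"
      by (auto simp: A_def B_def intro: quotientI)
    have mem: "x \<in> A" "z \<in> A" "y \<in> B" "t \<in> B"
      using equiv_class_self[OF eq xyn(1)] equiv_class_self[OF eq xyn(2)] * by (auto simp: A_def B_def)
    have "A \<noteq> B" using mem xy by (auto simp: A_def)
    then have "separated A B \<or> nested A B" using assms AB by (simp add: planar_def)
    moreover have fin: "finite A" "A \<noteq> {}" "finite B" "B \<noteq> {}"
      using class_finite[OF eq] AB by auto
    have bounds: "Min A \<le> x" "z \<le> Max A" "Min B \<le> y" "t \<le> Max B"
      using fin mem by auto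
    moreover have "\<not> separated A B"
      using bounds * by (auto simp: separated_def)
    moreover have "\<not> nested_by A B"
      using mem bounds * fin by (force simp: nested_by_iff)
    moreover have "\<not> nested_by B A"
      using mem bounds * fin by (force simp: nested_by_iff)
    ultimately show False by (simp add: nested_def)
  qed
  then show ?thesis unfolding noncrossing_def by blast
qed

section \<open>Classes of noncrossing equivalences\<close>

locale noncrossing_equiv =
  fixes n :: nat and r :: "(nat \<times> nat) set"
  assumes eq: "equiv {1..n} r" and nc: "noncrossing r"
begin

lemma rel_in: "(x, y) \<in> r \<Longrightarrow> x \<in> {1..n} \<and> y \<in> {1..n}"
  using eq by (auto simp: equiv_def)

lemma rel_refl: "x \<in> {1..n} \<Longrightarrow> (x, x) \<in> r"
  using eq by (meson equivE refl_onD)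

lemma rel_sym: "(x, y) \<in> r \<Longrightarrow> (y, x) \<in> r"
  using eq by (meson equivE symD)

lemma rel_trans: "(x, y) \<in> r \<Longrightarrow> (y, z) \<in> r \<Longrightarrow> (x, z) \<in> r"
  using eq by (meson equivE transD)

lemma crossing: "x < y \<Longrightarrow> y < z \<Longrightarrow> z < t \<Longrightarrow> (x, z) \<in> r \<Longrightarrow> (y, t) \<in> r \<Longrightarrow> (x, y) \<in> r"
  using nc unfolding noncrossing_def by blast

lemma class_rel:
  assumes "C \<in> {1..n} // r" "x \<in> C"
  shows "y \<in> C \<longleftrightarrow> (x, y) \<in> r"
proof -
  obtain z where z: "z \<in> {1..n}" "C = r `` {z}" using assms(1) by (rule quotientE)
  then show ?thesis using assms(2) rel_sym rel_trans by blast
qed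

lemma class_Min_Max:
  assumes "C \<in> {1..n} // r"
  shows "Min C \<in> C" "Max C \<in> C" "(Min C, Max C) \<in> r"
    "\<And>x. x \<in> C \<Longrightarrow> Min C \<le> x \<and> x \<le> Max C"
proof -
  show *: "Min C \<in> C" "Max C \<in> C" using class_finite[OF eq assms] by auto
  show "(Min C, Max C) \<in> r" using class_rel[OF assms *(1)] * by blast
  show "Min C \<le> x \<and> x \<le> Max C" if "x \<in> C" for x
    using class_finite[OF eq assms] that by auto
qed

lemma class_eqI:
  assumes "C \<in> {1..n} // r" "D \<in> {1..n} // r" "x \<in> C" "x \<in> D"
  shows "C = D"
  using class_rel[OF assms(1,3)] class_rel[OF assms(2,4)] by blast

lemma planar: "planar n r"
proof -
  have main: "nested_by B A" if AB: "A \<in> {1..n} // r" "B \<in> {1..n} // r" "A \<noteq> B"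
    and lt: "Min A < Min B" "Min B < Max A" for A B
  proof -
    note A = class_Min_Max[OF AB(1)] and B = class_Min_Max[OF AB(2)]
    have notin: "x \<notin> B" if "x \<in> A" for x using class_eqI[OF AB(1,2)] AB(3) that by blast
    \<comment> \<open>A point \<open>a\<close> of \<open>A\<close> strictly inside the range of
      \<open>B\<close> would give the crossing \<open>Min A < Min B < a < Max B\<close>, which
      merges the two classes.\<close>
    have gap: "a < Min B \<or> Max B < a" if a: "a \<in> A" for a
    proof (rule ccontr)
      assume "\<not> (a < Min B \<or> Max B < a)"
      then have "Min B < a" "a < Max B"
        using notin[OF a] B(1,2) by (auto simp: not_less le_less)
      moreover have "(Min A, a) \<in> r" using class_rel[OF AB(1) A(1)] a by blast
      ultimately have "(Min A, Min B) \<in> r" using crossing lt(1) B(3) by blast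
      then show False using class_rel[OF AB(1) A(1)] notin B(1) by blast
    qed
    have "Max B < Max A" using gap[OF A(2)] lt(2) by simp
    then show ?thesis
      using A(1,2) lt gap class_finite[OF eq AB(1)] class_finite[OF eq AB(2)]
      by (subst nested_by_iff) (blast+)
  qed
  have "separated A B \<or> nested A B" if AB: "A \<in> {1..n} // r" "B \<in> {1..n} // r" "A \<noteq> B" for A B
  proof -
    note A = class_Min_Max[OF AB(1)] and B = class_Min_Max[OF AB(2)]
    have ne: "Min A \<noteq> Min B" "Min B \<noteq> Max A" "Min A \<noteq> Max B"
      using class_eqI[OF AB(1,2)] AB(3) A B by metis+
    then consider "separated A B" | "Min A < Min B" "Min B < Max A" | "Min B < Min A" "Min A < Max B"
      unfolding separated_def by linarith
    then show ?thesis
      using main[of A B] main[of B A] AB unfolding nested_def by cases auto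
  qed
  then show ?thesis using eq by (simp add: planar_def)
qed

end

section \<open>The partitions \<open>d_part\<close>\<close>

text \<open>The pointwise counterpart of membership in \<open>outer_classes\<close>, see
  \<open>outer_class_iff\<close>. Only pairs of \<open>r\<close> occur, so the effect of adding an
  arc can be followed without listing classes.\<close>

definition outer :: "(nat \<times> nat) set \<Rightarrow> nat \<Rightarrow> bool" where
  "outer r y \<longleftrightarrow> \<not> (\<exists>u v. (u, v) \<in> r \<and> u < y \<and> y < v \<and> (u, y) \<notin> r)"

text \<open>One formula for both kinds of block, so that \<open>d_part\<close> becomes the image of
  a single map on classes.\<close>

definition block :: "nat \<Rightarrow> (nat \<times> nat) set \<Rightarrow> nat set \<Rightarrow> vertex set" where
  "block n r B =
     (if B \<in> outer_classes n r then Up ` {Min B..Max B} else {}) \<union> Dn ` B"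

text \<open>Arbitrary related points around \<open>x\<close> replace \<open>Min\<close> and
  \<open>Max\<close> of a class; the intervals between related points fill out exactly the range of
  the class.\<close>

definition d_labels :: "nat \<Rightarrow> (nat \<times> nat) set \<Rightarrow> (nat set \<times> nat set) set" where
  "d_labels n r = {(P, Q). P \<subseteq> {1..n} \<and> Q \<subseteq> {1..n} \<and>
     (\<forall>y z. (y, z) \<in> r \<longrightarrow> (y \<in> Q \<longleftrightarrow> z \<in> Q)) \<and>
     (\<forall>x y z. (y, z) \<in> r \<and> y \<le> x \<and> x \<le> z \<and> outer r y \<longrightarrow> (x \<in> P \<longleftrightarrow> y \<in> Q))}"

lemma d_labelsI:
  assumes "P \<subseteq> {1..n}" "Q \<subseteq> {1..n}" "\<And>y z. (y, z) \<in> r \<Longrightarrow> y \<in> Q \<longleftrightarrow> z \<in> Q"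
    "\<And>x y z. (y, z) \<in> r \<Longrightarrow> y \<le> x \<Longrightarrow> x \<le> z \<Longrightarrow> outer r y \<Longrightarrow> x \<in> P \<longleftrightarrow> y \<in> Q"
  shows "(P, Q) \<in> d_labels n r"
proof -
  have "\<forall>y z. (y, z) \<in> r \<longrightarrow> (y \<in> Q \<longleftrightarrow> z \<in> Q)"
    by (intro allI impI assms(3))
  moreover have "\<forall>x y z. (y, z) \<in> r \<and> y \<le> x \<and> x \<le> z \<and> outer r y \<longrightarrow> (x \<in> P \<longleftrightarrow> y \<in> Q)"
    by (intro allI impI; elim conjE) (rule assms(4))
  ultimately show ?thesis unfolding d_labels_def using assms(1,2) by blast
qed

lemma d_labelsD:
  assumes "(P, Q) \<in> d_labels n r"
  shows "P \<subseteq> {1..n}" "Q \<subseteq> {1..n}" "\<And>y z. (y, z) \<in> r \<Longrightarrow> y \<in> Q \<longleftrightarrow> z \<in> Q"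
    "\<And>x y z. (y, z) \<in> r \<Longrightarrow> y \<le> x \<Longrightarrow> x \<le> z \<Longrightarrow> outer r y \<Longrightarrow> x \<in> P \<longleftrightarrow> y \<in> Q"
proof -
  note h = assms[unfolded d_labels_def mem_Collect_eq prod.case]
  note h = h[THEN conjunct1] h[THEN conjunct2, THEN conjunct1]
    h[THEN conjunct2, THEN conjunct2, THEN conjunct1]
    h[THEN conjunct2, THEN conjunct2, THEN conjunct2]
  show "P \<subseteq> {1..n}" "Q \<subseteq> {1..n}" by (fact h)+
  show "y \<in> Q \<longleftrightarrow> z \<in> Q" if "(y, z) \<in> r" for y z
    using h(3)[rule_format, OF that] .
  show "x \<in> P \<longleftrightarrow> y \<in> Q" if "(y, z) \<in> r" "y \<le> x" "x \<le> z" "outer r y" for x y z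
    using that by (intro h(4)[rule_format, of y z]) auto
qed

context noncrossing_equiv
begin

text \<open>If a pair of another class jumps over \<open>y\<close>, noncrossing keeps that whole
  class out of the range of \<open>B\<close>, so \<open>B\<close> sits in one of its gaps.
  Conversely, a gap around \<open>B\<close> supplies a pair jumping over \<open>y\<close>.\<close>

lemma outer_class_iff:
  assumes B: "B \<in> {1..n} // r" and y: "y \<in> B"
  shows "B \<in> outer_classes n r \<longleftrightarrow> outer r y"
proof -
  note B' = class_Min_Max[OF B]
  have nest: "nested_by B C \<longleftrightarrow> (\<exists>u \<in> C. u < Min B) \<and> (\<exists>v \<in> C. Max B < v) \<and>
      (\<forall>c \<in> C. c < Min B \<or> Max B < c)" if "C \<in> {1..n} // r" for C
    using class_finite[OF eq B] class_finite[OF eq that] by (intro nested_by_iff) auto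
  have "outer r y" if out: "B \<in> outer_classes n r"
  proof (rule ccontr)
    assume "\<not> outer r y"
    then obtain u v where uv: "(u, v) \<in> r" "u < y" "y < v" "(u, y) \<notin> r"
      unfolding outer_def by blast
    define C where "C = r `` {u}"
    have C: "C \<in> {1..n} // r" using rel_in[OF uv(1)] by (auto simp: C_def intro: quotientI)
    have uC: "u \<in> C" "v \<in> C" using uv rel_in[OF uv(1)] rel_refl by (auto simp: C_def)
    have yC: "y \<notin> C" using uv(4) by (simp add: C_def)
    have notin: "c \<notin> B" if "c \<in> C" for c using class_eqI[OF B C _ that] y yC by blast
    have gap: "c < Min B \<or> Max B < c" if c: "c \<in> C" for c
    proof (rule ccontr)
      assume "\<not> (c < Min B \<or> Max B < c)"
      then have c': "Min B < c" "c < Max B"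
        using notin[OF c] B'(1,2) by (auto simp: not_less le_less)
      have My: "(Min B, y) \<in> r" "(y, Max B) \<in> r"
        using class_rel[OF B] B' y by blast+
      have cuv: "(c, v) \<in> r" "(u, c) \<in> r" using class_rel[OF C] c uC by blast+
      \<comment> \<open>For \<open>c < y\<close> the crossing is \<open>Min B < c < y < v\<close>,
        for \<open>y < c\<close> it is \<open>u < y < c < Max B\<close>.\<close>
      consider "c < y" | "y < c" using yC c by (metis linorder_neqE_nat)
      then show False
      proof cases
        case 1
        then have "(Min B, c) \<in> r" using crossing c' My(1) cuv(1) uv(3) by blast
        then show False using class_rel[OF B B'(1)] notin[OF c] by blast
      next
        case 2
        then have "(u, y) \<in> r" using crossing uv(2) c' My(2) cuv(2) by blast
        then show False using uv(4) by blast
      qed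
    qed
    have "u < Min B" "Max B < v"
      using gap[OF uC(1)] gap[OF uC(2)] uv B'(4)[OF y] by auto
    then have "nested_by B C" using nest[OF C] uC gap by blast
    moreover have "C \<noteq> B" using y yC by blast
    ultimately show False using out C unfolding outer_classes_def by blast
  qed
  moreover have "B \<in> outer_classes n r" if out: "outer r y"
  proof (rule ccontr)
    assume "B \<notin> outer_classes n r"
    then obtain C where C: "C \<in> {1..n} // r" "C \<noteq> B" "nested_by B C"
      using B unfolding outer_classes_def by blast
    then obtain u v where uv: "u \<in> C" "u < Min B" "v \<in> C" "Max B < v"
      using nest[OF C(1)] by blast
    have "(u, v) \<in> r" using class_rel[OF C(1)] uv by blast
    moreover have "u < y" "y < v" using uv B'(4)[OF y] by auto
    ultimately have "(u, y) \<in> r" using out unfolding outer_def by blast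
    then have "y \<in> C" using class_rel[OF C(1) uv(1)] by blast
    then show False using class_eqI[OF B C(1) y] C(2) by blast
  qed
  ultimately show ?thesis by blast
qed

lemma d_part_eq: "d_part n r = block n r ` ({1..n} // r)"
proof -
  have sub: "outer_classes n r \<subseteq> {1..n} // r" by (auto simp: outer_classes_def)
  have "{x \<in> {1..n}. Min B \<le> x \<and> x \<le> Max B} = {Min B..Max B}" if "B \<in> outer_classes n r" for B
  proof -
    have B: "B \<in> {1..n} // r" using that sub by blast
    then have "Min B \<in> {1..n}" "Max B \<in> {1..n}"
      using class_Min_Max[OF B] class_finite(3)[OF eq B] by blast+
    then show ?thesis by auto
  qed
  then have "Up ` {x \<in> {1..n}. Min B \<le> x \<and> x \<le> Max B} \<union> Dn ` B = block n r B"
    if "B \<in> outer_classes n r" for B using that by (simp add: block_def)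
  then have outer: "{Up ` {x \<in> {1..n}. Min B \<le> x \<and> x \<le> Max B} \<union> Dn ` B |B. B \<in> outer_classes n r} =
      block n r ` outer_classes n r"
    unfolding image_def by (intro Collect_cong) blast
  have inner: "{Dn ` C |C. C \<in> {1..n} // r - outer_classes n r} =
      block n r ` ({1..n} // r - outer_classes n r)"
    by (auto simp: block_def)
  show ?thesis
    unfolding d_part_def outer inner image_Un[symmetric] using sub by (simp add: Un_absorb1)
qed

text \<open>Take a pair around \<open>x\<close> with least left point \<open>y\<close>. A pair
  \<open>(u, v)\<close> jumping over \<open>y\<close> either still surrounds \<open>x\<close>,
  against minimality, or ends before \<open>x\<close> and crosses \<open>(y, z)\<close>, which puts
  \<open>u\<close> and \<open>y\<close> in one class.\<close>

lemma outer_cover: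
  assumes "x \<in> {1..n}"
  shows "\<exists>y z. (y, z) \<in> r \<and> y \<le> x \<and> x \<le> z \<and> outer r y"
proof -
  define y where "y = (LEAST y. y \<le> x \<and> (\<exists>z \<ge> x. (y, z) \<in> r))"
  have "x \<le> x \<and> (\<exists>z \<ge> x. (x, z) \<in> r)" using assms rel_refl by blast
  then have "y \<le> x \<and> (\<exists>z \<ge> x. (y, z) \<in> r)" unfolding y_def by (rule LeastI)
  then obtain z where yz: "y \<le> x" "x \<le> z" "(y, z) \<in> r" by blast
  have least: "y \<le> u" if "u \<le> x" "x \<le> v" "(u, v) \<in> r" for u v
    unfolding y_def using that by (intro Least_le) blast
  have "outer r y"
    unfolding outer_def
  proof
    assume "\<exists>u v. (u, v) \<in> r \<and> u < y \<and> y < v \<and> (u, y) \<notin> r"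
    then obtain u v where uv: "(u, v) \<in> r" "u < y" "y < v" "(u, y) \<notin> r" by blast
    then have "v < x" using least[of u v] yz by (meson le_trans less_imp_le not_le)
    then have "v < z" using yz by simp
    then show False using crossing[OF uv(2,3)] uv yz by blast
  qed
  then show ?thesis using yz by blast
qed

text \<open>The larger of the two left points lies within the pair of the other and, being outer,
  cannot be jumped over by a foreign class. So ranges of distinct outer classes are disjoint, as the
  upper parts of blocks must be.\<close>

lemma outer_unique:
  assumes "(y, z) \<in> r" "y \<le> x" "x \<le> z" "outer r y"
    and "(y', z') \<in> r" "y' \<le> x" "x \<le> z'" "outer r y'"
  shows "(y, y') \<in> r"
proof -
  have *: "(y, y') \<in> r" if "(y, z) \<in> r" "y' \<in> {1..n}" "y \<le> y'" "y' \<le> z" "outer r y'" for y y' z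
  proof (cases "y < y' \<and> y' < z")
    case True
    then show ?thesis using that unfolding outer_def by blast
  next
    case False
    then have "y' = y \<or> y' = z" using that by auto
    then show ?thesis using that rel_refl by blast
  qed
  show ?thesis
  proof (cases "y \<le> y'")
    case True
    then show ?thesis using *[of y z y'] assms rel_in[of y' z'] by simp
  next
    case False
    then have "(y', y) \<in> r" using *[of y' z' y] assms rel_in[of y z] by simp
    then show ?thesis by (rule rel_sym)
  qed
qed

lemma block_disjoint:
  assumes "B \<in> {1..n} // r" "C \<in> {1..n} // r" "v \<in> block n r B" "v \<in> block n r C"
  shows "B = C"
proof (cases v)
  case (Up x)
  have *: "outer r (Min B) \<and> Min B \<le> x \<and> x \<le> Max B" if "B \<in> {1..n} // r" "v \<in> block n r B" for B
    using that outer_class_iff[OF that(1) class_Min_Max(1)[OF that(1)]] Up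
    by (auto simp: block_def split: if_splits)
  note B = *[OF assms(1,3)] and C = *[OF assms(2,4)]
  have "(Min B, Min C) \<in> r"
    using outer_unique[OF class_Min_Max(3)[OF assms(1)] _ _ _ class_Min_Max(3)[OF assms(2)]] B C
    by blast
  then have "Min C \<in> B" using class_rel[OF assms(1) class_Min_Max(1)[OF assms(1)]] by blast
  then show ?thesis using class_eqI[OF assms(1,2)] class_Min_Max(1)[OF assms(2)] by blast
next
  case (Dn x)
  then have "x \<in> B" "x \<in> C" using assms by (auto simp: block_def split: if_splits)
  then show ?thesis using class_eqI[OF assms(1,2)] by blast
qed (use assms in \<open>auto simp: block_def split: if_splits\<close>)

lemma partition_on_d_part: "partition_on (verts n) (d_part n r)"
proof (rule partition_onI)
  show "disjnt C D" if "C \<in> d_part n r" "D \<in> d_part n r" "C \<noteq> D" for C D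
    using that block_disjoint unfolding d_part_eq disjnt_def by blast
  show "{} \<notin> d_part n r"
    using class_finite(2)[OF eq] unfolding d_part_eq block_def by blast
  show "\<Union> (d_part n r) = verts n"
  proof (intro equalityI subsetI)
    fix v assume "v \<in> \<Union> (d_part n r)"
    then obtain B where B: "B \<in> {1..n} // r" "v \<in> block n r B" unfolding d_part_eq by blast
    have "Min B \<in> {1..n}" "Max B \<in> {1..n}" "B \<subseteq> {1..n}"
      using class_Min_Max[OF B(1)] class_finite(3)[OF eq B(1)] by blast+
    then have "{Min B..Max B} \<subseteq> {1..n}" by auto
    then show "v \<in> verts n" using B(2) \<open>B \<subseteq> {1..n}\<close>
      unfolding block_def verts_def by (auto split: if_splits)
  next
    fix v assume "v \<in> verts n"
    then consider x where "x \<in> {1..n}" "v = Up x" | x where "x \<in> {1..n}" "v = Dn x"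
      unfolding verts_def by blast
    then show "v \<in> \<Union> (d_part n r)"
    proof cases
      case (1 x)
      obtain y z where yz: "(y, z) \<in> r" "y \<le> x" "x \<le> z" "outer r y"
        using outer_cover[OF 1(1)] by blast
      define B where "B = r `` {y}"
      have B: "B \<in> {1..n} // r" using rel_in[OF yz(1)] by (auto simp: B_def intro: quotientI)
      have yB: "y \<in> B" "z \<in> B" using yz rel_in[OF yz(1)] rel_refl by (auto simp: B_def)
      have "x \<in> {Min B..Max B}"
        using class_Min_Max(4)[OF B yB(1)] class_Min_Max(4)[OF B yB(2)] yz by simp
      then have "v \<in> block n r B"
        using outer_class_iff[OF B yB(1)] yz(4) 1(2) by (simp add: block_def)
      then show ?thesis using B unfolding d_part_eq by blast
    next
      case (2 x)
      then have "v \<in> block n r (r `` {x})" using rel_refl by (simp add: block_def)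
      then show ?thesis using quotientI[OF 2(1), of r] unfolding d_part_eq by blast
    qed
  qed
qed

lemma labels_d_part: "labels n (d_part n r) = d_labels n r"
proof (intro equalityI subrelI)
  fix P Q assume PQ: "(P, Q) \<in> labels n (d_part n r)"
  have c: "label P Q u \<longleftrightarrow> label P Q v"
    if "B \<in> {1..n} // r" "u \<in> block n r B" "v \<in> block n r B" for B u v
  proof -
    have "block n r B \<in> d_part n r" using that(1) unfolding d_part_eq by blast
    from labelsD[OF PQ this that(2,3)] show ?thesis .
  qed
  show "(P, Q) \<in> d_labels n r"
  proof (rule d_labelsI[OF labels_subset[OF PQ]])
    fix y z assume yz: "(y, z) \<in> r"
    define B where "B = r `` {y}"
    have B: "B \<in> {1..n} // r" using rel_in[OF yz] by (auto simp: B_def intro: quotientI)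
    have yB: "y \<in> B" "z \<in> B" using yz rel_in[OF yz] rel_refl by (auto simp: B_def)
    then have blk: "Dn y \<in> block n r B" "Dn z \<in> block n r B" by (auto simp: block_def)
    from c[OF B this] show "y \<in> Q \<longleftrightarrow> z \<in> Q" by simp
    fix x assume x: "y \<le> x" "x \<le> z" "outer r y"
    have "x \<in> {Min B..Max B}"
      using class_Min_Max(4)[OF B yB(1)] class_Min_Max(4)[OF B yB(2)] x by simp
    then have "Up x \<in> block n r B"
      using outer_class_iff[OF B yB(1)] x(3) by (simp add: block_def)
    from c[OF B this blk(1)] show "x \<in> P \<longleftrightarrow> y \<in> Q" by simp
  qed
next
  fix P Q assume "(P, Q) \<in> d_labels n r"
  note PQ = d_labelsD[OF this]
  show "(P, Q) \<in> labels n (d_part n r)"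
  proof (rule labelsI_value[OF PQ(1,2)])
    fix C assume "C \<in> d_part n r"
    then obtain B where B: "B \<in> {1..n} // r" "C = block n r B" unfolding d_part_eq by blast
    note M = class_Min_Max[OF B(1)]
    have "label P Q v \<longleftrightarrow> Min B \<in> Q" if v: "v \<in> C" for v
    proof -
      consider x where "v = Up x" "x \<in> {Min B..Max B}" "outer r (Min B)" | x where "v = Dn x" "x \<in> B"
        using v outer_class_iff[OF B(1) M(1)] unfolding B(2) block_def by (auto split: if_splits)
      then show ?thesis
      proof cases
        case (1 x)
        then show ?thesis using PQ(4)[OF M(3), of x] by simp
      next
        case (2 x)
        then have "(Min B, x) \<in> r" using class_rel[OF B(1) M(1)] by blast
        then show ?thesis using PQ(3)[of "Min B" x] 2 by simp
      qed
    qed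
    then show "\<exists>v. \<forall>x \<in> C. label P Q x \<longleftrightarrow> v" by blast
  qed
qed

lemma rel_iff_d_part: "(x, y) \<in> r \<longleftrightarrow> (\<exists>C \<in> d_part n r. Dn x \<in> C \<and> Dn y \<in> C)"
proof
  assume xy: "(x, y) \<in> r"
  define B where "B = r `` {x}"
  have "B \<in> {1..n} // r" using rel_in[OF xy] by (auto simp: B_def intro: quotientI)
  moreover have "x \<in> B" "y \<in> B" using xy rel_in[OF xy] rel_refl by (auto simp: B_def)
  then have "Dn x \<in> block n r B" "Dn y \<in> block n r B" by (auto simp: block_def)
  ultimately show "\<exists>C \<in> d_part n r. Dn x \<in> C \<and> Dn y \<in> C" unfolding d_part_eq by blast
next
  assume "\<exists>C \<in> d_part n r. Dn x \<in> C \<and> Dn y \<in> C"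
  then obtain B where B: "B \<in> {1..n} // r" "Dn x \<in> block n r B" "Dn y \<in> block n r B"
    unfolding d_part_eq by blast
  then have "x \<in> B" "y \<in> B" by (auto simp: block_def split: if_splits)
  then show "(x, y) \<in> r" using class_rel[OF B(1)] by blast
qed

end

section \<open>Normal words and noncrossing equivalences\<close>

text \<open>Intended for an equivalence \<open>r\<close> in which \<open>a\<close> is alone in its
  class: the result is then already transitive, hence the equivalence generated by \<open>r\<close>
  and \<open>(a, b)\<close>.\<close>

definition link :: "nat \<Rightarrow> nat \<Rightarrow> (nat \<times> nat) set \<Rightarrow> (nat \<times> nat) set" where
  "link a b r = r \<union> {a} \<times> r `` {b} \<union> r `` {b} \<times> {a}"

fun arc_rel :: "nat \<Rightarrow> letter list \<Rightarrow> (nat \<times> nat) set" where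
  "arc_rel n [] = Id_on {1..n}"
| "arc_rel n (H a b # w) = link a b (arc_rel n w)"

text \<open>The analogue of \<open>clear\<close> for equivalences. A chain of arcs leading from
  below \<open>m\<close> to \<open>m\<close> or beyond contains an arc that does so, hence all
  related points can be compared instead of neighbours.\<close>

definition clear_rel :: "nat \<Rightarrow> nat \<Rightarrow> (nat \<times> nat) set \<Rightarrow> bool" where
  "clear_rel k m r \<longleftrightarrow>
     (\<forall>x y. (x, y) \<in> r \<and> x \<noteq> y \<longrightarrow> k < x \<and> k < y \<and> (x < m \<longleftrightarrow> y < m))"

lemma clear_relD:
  assumes "clear_rel k m r" "(x, y) \<in> r" "x \<noteq> y"
  shows "k < x" "k < y" "x < m \<longleftrightarrow> y < m"
  using assms unfolding clear_rel_def by blast+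

text \<open>The state just before an arc from \<open>a\<close> to \<open>b\<close> is prepended. The
  assumption \<open>cl\<close> makes the points up to \<open>a\<close> singleton classes and
  \<open>b\<close> the least point of its class.\<close>

locale linked = noncrossing_equiv +
  fixes a b :: nat
  assumes a1: "1 \<le> a" and ab: "a < b" and bn: "b \<le> n" and cl: "clear_rel a b r"
begin

lemma a_trivial: "(a, x) \<in> r \<Longrightarrow> x = a" "(x, a) \<in> r \<Longrightarrow> x = a"
  using clear_relD[OF cl] by blast+

lemma small_trivial: "(x, y) \<in> r \<Longrightarrow> x \<le> a \<or> y \<le> a \<Longrightarrow> x = y"
  using clear_relD(1,2)[OF cl, of x y] by (meson not_le)

lemma b_cut: "(x, y) \<in> r \<Longrightarrow> x < b \<longleftrightarrow> y < b"
  using clear_relD(3)[OF cl, of x y] by blast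

lemma ab_in: "a \<in> {1..n}" "b \<in> {1..n}"
  using a1 ab bn by auto

lemma link_iff: "(x, y) \<in> link a b r \<longleftrightarrow> (x, y) \<in> r \<or> x = a \<and> (b, y) \<in> r \<or> y = a \<and> (b, x) \<in> r"
  by (auto simp: link_def)

lemma linkE:
  assumes "(x, y) \<in> link a b r"
  obtains "(x, y) \<in> r" | "x = a" "(b, y) \<in> r" "b \<le> y" | "y = a" "(b, x) \<in> r" "b \<le> x"
proof -
  have "b \<le> y" if "(b, y) \<in> r" for y using b_cut[OF that] by simp
  then show ?thesis using assms that unfolding link_iff by blast
qed

lemma equiv_link: "equiv {1..n} (link a b r)"
proof (rule equivI)
  show "link a b r \<subseteq> {1..n} \<times> {1..n}"
  proof (rule subrelI)
    fix x y assume "(x, y) \<in> link a b r"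
    then show "(x, y) \<in> {1..n} \<times> {1..n}"
      using rel_in ab_in unfolding link_iff by blast
  qed
  show "refl_on {1..n} (link a b r)"
    using rel_refl by (auto simp: refl_on_def link_iff)
  show "sym (link a b r)"
    by (rule symI) (use rel_sym in \<open>auto simp: link_iff\<close>)
  show "trans (link a b r)"
  proof (rule transI)
    fix x y z assume "(x, y) \<in> link a b r" "(y, z) \<in> link a b r"
    moreover have "(a, a) \<in> r" "(b, b) \<in> r" using ab_in rel_refl by blast+
    ultimately show "(x, z) \<in> link a b r"
      using rel_sym rel_trans a_trivial unfolding link_iff by meson
  qed
qed

text \<open>In a crossing \<open>x < y < z < t\<close> the pair \<open>(y, t)\<close> is old, since
  \<open>y\<close> and \<open>t\<close> exceed \<open>a\<close>. The new case is
  \<open>x = a\<close> with \<open>z\<close> in the class of \<open>b\<close>; then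
  \<open>b \<le> y\<close> because no class straddles \<open>b\<close>, and \<open>b\<close> can
  take the place of \<open>a\<close>.\<close>

lemma noncrossing_link: "noncrossing (link a b r)"
proof -
  have "(x, y) \<in> link a b r"
    if *: "x < y" "y < z" "z < t" "(x, z) \<in> link a b r" "(y, t) \<in> link a b r" for x y z t
  proof -
    have "x \<ge> a" using *(4)
    proof (cases rule: linkE)
      case 1
      then show ?thesis using small_trivial[OF 1] * by (cases "x \<le> a") auto
    qed (use ab in auto)
    then have yt: "(y, t) \<in> r" using * ab by (auto elim!: linkE)
    show ?thesis using *(4)
    proof (cases rule: linkE)
      case 1
      then show ?thesis using crossing[OF *(1-3) 1 yt] by (simp add: link_iff)
    next
      case 2
      have "b \<le> y" using b_cut[OF yt] 2(3) * by auto
      then consider "y = b" | "b < y" by linarith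
      then show ?thesis
      proof cases
        case 1
        then show ?thesis using 2 rel_refl ab_in by (simp add: link_iff)
      next
        case 2
        then show ?thesis using crossing[OF 2 *(2,3) \<open>(b, z) \<in> r\<close> yt] \<open>x = a\<close>
          by (simp add: link_iff)
      qed
    next
      case 3
      then show ?thesis using * \<open>x \<ge> a\<close> by simp
    qed
  qed
  then show ?thesis unfolding noncrossing_def by blast
qed

lemma clear_rel_link:
  assumes "clear_rel k m r" "k < a" "m \<le> a \<or> b < m"
  shows "clear_rel k m (link a b r)"
proof -
  have *: "k < y \<and> (a < m \<longleftrightarrow> y < m)" if "(b, y) \<in> r" "b \<le> y" for y
    using clear_relD(3)[OF assms(1) that(1)] assms(2,3) ab that(2) by (cases "y = b") auto
  show ?thesis
    unfolding clear_rel_def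
  proof (intro allI impI, elim conjE)
    fix x y assume xy: "(x, y) \<in> link a b r" "x \<noteq> y"
    show "k < x \<and> k < y \<and> (x < m \<longleftrightarrow> y < m)"
      using xy(1)
    proof (cases rule: linkE)
      case 1
      then show ?thesis using clear_relD[OF assms(1) 1 xy(2)] by blast
    next
      case 2
      then show ?thesis using * assms(2) by blast
    next
      case 3
      then show ?thesis using * assms(2) by blast
    qed
  qed
qed

lemma link_noncrossing_equiv: "noncrossing_equiv n (link a b r)"
  using equiv_link noncrossing_link by (rule noncrossing_equiv.intro)

lemma outer_small: "y \<le> a \<Longrightarrow> outer r y \<and> outer (link a b r) y"
proof -
  assume y: "y \<le> a"
  have "(u, y) \<in> s" if "(u, v) \<in> s" "u < y" "y < v" "s = r \<or> s = link a b r" for u v s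
  proof -
    have "(u, v) \<in> link a b r" using that(1,4) by (auto simp: link_iff)
    then show ?thesis
    proof (cases rule: linkE)
      case 1
      then show ?thesis using small_trivial[OF 1] y that by auto
    qed (use that y ab in auto)
  qed
  then show ?thesis unfolding outer_def by blast
qed

text \<open>A new pair jumping over \<open>y\<close> leads from \<open>a\<close> to some
  \<open>v\<close> in the class of \<open>b\<close>. Unless \<open>y = b\<close>, the old pair
  \<open>(b, v)\<close> jumps over \<open>y\<close> too, so a \<open>y\<close> that is outer in
  \<open>r\<close> belongs to the class of \<open>b\<close>, which \<open>a\<close> has
  joined.\<close>

lemma outer_large: "b \<le> y \<Longrightarrow> outer (link a b r) y \<longleftrightarrow> outer r y"
proof -
  assume y: "b \<le> y"
  have "outer (link a b r) y" if out: "outer r y"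
    unfolding outer_def
  proof (rule notI, elim exE conjE)
    fix u v assume uv: "(u, v) \<in> link a b r" "u < y" "y < v" "(u, y) \<notin> link a b r"
    from uv(1) show False
    proof (cases rule: linkE)
      case 1
      then show ?thesis using uv out unfolding outer_def link_iff by blast
    next
      case 2
      have "(b, y) \<in> r"
      proof (cases "y = b")
        case True
        then show ?thesis using rel_refl ab_in by blast
      next
        case False
        then show ?thesis using out 2 y uv(3) unfolding outer_def by auto
      qed
      then show ?thesis using 2 uv(4) by (simp add: link_iff)
    next
      case 3
      then show ?thesis using uv y ab by simp
    qed
  qed
  moreover have "outer r y" if out: "outer (link a b r) y"
    unfolding outer_def
  proof (rule notI, elim exE conjE)
    fix u v assume uv: "(u, v) \<in> r" "u < y" "y < v" "(u, y) \<notin> r"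
    then have "(u, y) \<in> link a b r" using out unfolding outer_def link_iff by blast
    then have "u = a" using uv(4) y ab by (auto elim!: linkE)
    then show False using uv a_trivial(1)[of v] by auto
  qed
  ultimately show ?thesis by blast
qed

lemma not_outer_middle: "a < y \<Longrightarrow> y < b \<Longrightarrow> \<not> outer (link a b r) y"
proof -
  assume y: "a < y" "y < b"
  have "(a, b) \<in> link a b r" using rel_refl ab_in by (simp add: link_iff)
  moreover have "(a, y) \<notin> link a b r" using y a_trivial by (auto elim!: linkE)
  ultimately show ?thesis using y unfolding outer_def by blast
qed

lemma outer_b: "outer r b"
  unfolding outer_def using b_cut by auto

text \<open>For the converse inclusion, the middle labelling takes on the interior of \<open>[a, b]\<close> the value
  that \<open>Q\<close> prescribes, and agrees with \<open>P\<close> elsewhere.\<close>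

lemma h_labels_O_d_labels: "h_labels n a b O d_labels n r = d_labels n (link a b r)"
proof (intro equalityI subrelI)
  fix P Q assume "(P, Q) \<in> h_labels n a b O d_labels n r"
  then obtain M where PM: "(P, M) \<in> h_labels n a b" and MQ: "(M, Q) \<in> d_labels n r" by blast
  note PM = h_labelsD[OF PM] and MQ = d_labelsD[OF MQ]
  \<comment> \<open>Both \<open>a\<close> and \<open>b\<close> are outer in \<open>r\<close>, so
    their lower labels are those of \<open>M\<close>, and at these two points \<open>M\<close>
    agrees with \<open>P\<close>.\<close>
  have aQ: "a \<in> Q \<longleftrightarrow> a \<in> P"
    using MQ(4)[of a a a] PM(4)[of a] rel_refl ab_in outer_small[of a] ab by simp
  have "b \<in> Q \<longleftrightarrow> b \<in> M"
    using MQ(4)[of b b b] rel_refl ab_in outer_b by simp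
  then have bQ: "b \<in> Q \<longleftrightarrow> a \<in> P"
    using PM(4)[of b] PM(3)[of b] ab by simp
  have Q: "y \<in> Q \<longleftrightarrow> a \<in> P" if "(b, y) \<in> r" for y
    using MQ(3)[OF that] bQ by blast
  have far: "x \<in> P \<longleftrightarrow> y \<in> Q"
    if "(y, z) \<in> r" "y \<le> x" "x \<le> z" "outer r y" "x \<le> a \<or> b \<le> x" for x y z
    using MQ(4)[OF that(1-4)] PM(4)[OF that(5)] ab by simp
  show "(P, Q) \<in> d_labels n (link a b r)"
  proof (rule d_labelsI[OF PM(1) MQ(2)])
    show "y \<in> Q \<longleftrightarrow> z \<in> Q" if "(y, z) \<in> link a b r" for y z
      using that
    proof (cases rule: linkE)
      case 1
      then show ?thesis by (rule MQ(3))
    next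
      case 2
      then show ?thesis using Q[of z] aQ by blast
    next
      case 3
      then show ?thesis using Q[of y] aQ by blast
    qed
    fix x y z assume *: "(y, z) \<in> link a b r" "y \<le> x" "x \<le> z" "outer (link a b r) y"
    show "x \<in> P \<longleftrightarrow> y \<in> Q"
      using *(1)
    proof (cases rule: linkE)
      case 1
      show ?thesis
      proof (cases "y \<le> a")
        case True
        then have "y = z" using small_trivial[OF 1] by blast
        then show ?thesis using far[OF 1 *(2,3)] outer_small[OF True] * True by simp
      next
        case False
        then have "b \<le> y" using not_outer_middle[of y] *(4) not_le by blast
        then show ?thesis using far[OF 1 *(2,3)] outer_large[of y] * by simp
      qed
    next
      case 2
      \<comment> \<open>The new pair covers \<open>{a..b}\<close>, where \<open>P\<close> is
        constant, and beyond it only points under the old pair \<open>(b, z)\<close>.\<close>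
      show ?thesis
      proof (cases "x \<le> b")
        case True
        then show ?thesis using PM(3)[of x] *(2) 2(1) aQ by simp
      next
        case False
        then have "x \<in> P \<longleftrightarrow> b \<in> Q" using far[OF 2(2) _ *(3) outer_b] by simp
        then show ?thesis using bQ aQ 2(1) by simp
      qed
    next
      case 3
      then show ?thesis using * ab by simp
    qed
  qed
next
  fix P Q assume "(P, Q) \<in> d_labels n (link a b r)"
  note PQ = d_labelsD[OF this]
  define M where "M = {x. if a < x \<and> x < b
    then \<exists>y z. (y, z) \<in> r \<and> y \<le> x \<and> x \<le> z \<and> outer r y \<and> y \<in> Q else x \<in> P}"
  have M_far: "x \<in> M \<longleftrightarrow> x \<in> P" if "x \<le> a \<or> b \<le> x" for x
    using that by (auto simp: M_def)
  have sub: "x \<in> {1..n}" if "(y, z) \<in> r" "y \<le> x" "x \<le> z" for x y z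
    using rel_in[OF that(1)] that by auto
  have M_mid: "x \<in> M \<longleftrightarrow> y \<in> Q"
    if x: "a < x" "x < b" and *: "(y, z) \<in> r" "y \<le> x" "x \<le> z" "outer r y" for x y z
  proof
    assume "x \<in> M"
    then obtain y' z' where **: "(y', z') \<in> r" "y' \<le> x" "x \<le> z'" "outer r y'" "y' \<in> Q"
      using x by (auto simp: M_def)
    have "(y, y') \<in> r" using outer_unique[OF * **(1-4)] .
    then have "(y, y') \<in> link a b r" by (simp add: link_iff)
    then show "y \<in> Q" using PQ(3) **(5) by blast
  next
    assume "y \<in> Q"
    then show "x \<in> M" using x * by (auto simp: M_def)
  qed
  have "M \<subseteq> {1..n}"
    using PQ(1) sub by (auto simp: M_def split: if_splits)
  have "(a, b) \<in> link a b r" using rel_refl ab_in by (simp add: link_iff)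
  then have aP: "x \<in> P \<longleftrightarrow> a \<in> Q" if "a \<le> x" "x \<le> b" for x
    using PQ(4)[of a b x] that outer_small[of a] by simp
  have "(P, M) \<in> h_labels n a b"
  proof (rule h_labelsI[OF PQ(1) \<open>M \<subseteq> {1..n}\<close>])
    show "x \<in> P \<longleftrightarrow> a \<in> P" if "a \<le> x" "x \<le> b" for x
      using aP[OF that] aP[of a] ab by simp
  qed (use ab M_far in auto)
  moreover have "(M, Q) \<in> d_labels n r"
  proof (rule d_labelsI[OF \<open>M \<subseteq> {1..n}\<close> PQ(2)])
    show "y \<in> Q \<longleftrightarrow> z \<in> Q" if "(y, z) \<in> r" for y z
      using that by (intro PQ(3)) (simp add: link_iff)
    show "x \<in> M \<longleftrightarrow> y \<in> Q" if *: "(y, z) \<in> r" "y \<le> x" "x \<le> z" "outer r y" for x y z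
    proof (cases "a < x \<and> x < b")
      case True
      then show ?thesis using M_mid * by blast
    next
      case False
      have "outer (link a b r) y"
      proof (cases "y < b")
        case True
        \<comment> \<open>An old pair starting below \<open>b\<close> also ends below
          \<open>b\<close>, so \<open>x\<close>, being outside the open interval, is at most
          \<open>a\<close>; all points up to there are outer.\<close>
        then have "z < b" using b_cut[OF *(1)] by simp
        then have "x \<le> a" using False * by simp
        then show ?thesis using outer_small[of y] * by simp
      next
        case False
        then show ?thesis using outer_large[of y] * by simp
      qed
      moreover have "(y, z) \<in> link a b r" using * by (simp add: link_iff)
      ultimately show ?thesis using PQ(4)[of y z x] * M_far[of x] False by auto
    qed
  qed
  ultimately show "(P, Q) \<in> h_labels n a b O d_labels n r" by blast
qed

end

section \<open>Reconstructing arcs from equivalences\<close>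

lemma link_le:
  assumes "linked n r a b" "linked n r' a' b'" "link a b r = link a' b' r'"
  shows "a' \<le> a"
proof -
  interpret l: linked n r a b by fact
  interpret l': linked n r' a' b' by fact
  have "(a, b) \<in> link a' b' r'"
    unfolding assms(3)[symmetric] using l.rel_refl l.ab_in by (simp add: l.link_iff)
  then show ?thesis
  proof (cases rule: l'.linkE)
    case 1
    then show ?thesis using l'.small_trivial[OF 1] l.ab by (cases "a \<le> a'") auto
  qed (use l'.ab in auto)
qed

text \<open>In the linked relation, \<open>a\<close> is the least point of a nontrivial class and
  \<open>b\<close> the next point of that class; isolating \<open>a\<close> again gives back
  \<open>r\<close>.\<close>

lemma link_inj:
  assumes l: "linked n r a b" and l': "linked n r' a' b'" and eq: "link a b r = link a' b' r'"
  shows "a = a' \<and> b = b' \<and> r = r'"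
proof -
  have a: "a = a'" using link_le[OF l l' eq] link_le[OF l' l eq[symmetric]] by simp
  have *: "b' \<le> b \<and> r \<subseteq> r'"
    if l: "linked n r a b" and l': "linked n r' a b'" and eq: "link a b r = link a b' r'" for b b' r r'
  proof -
    interpret l: linked n r a b by fact
    interpret l': linked n r' a b' by fact
    have "(a, b) \<in> link a b' r'"
      unfolding eq[symmetric] using l.rel_refl l.ab_in by (simp add: l.link_iff)
    then have "b' \<le> b" using l'.a_trivial(1)[of b] l.ab by (elim l'.linkE) auto
    moreover have "(x, y) \<in> r'" if xy: "(x, y) \<in> r" for x y
    proof -
      have "(x, y) \<in> link a b' r'" unfolding eq[symmetric] using xy by (simp add: l.link_iff)
      then show ?thesis
      proof (cases rule: l'.linkE)
        case 2
        then show ?thesis using xy l.a_trivial(1)[of y] l'.ab by simp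
      next
        case 3
        then show ?thesis using xy l.a_trivial(2)[of x] l'.ab by simp
      qed
    qed
    ultimately show ?thesis by auto
  qed
  show ?thesis
    using a *[OF l l'[folded a] eq[folded a]] *[OF l'[folded a] l eq[folded a, symmetric]] by auto
qed

lemma arc_rel_Nil: "noncrossing_equiv n (Id_on {1..n})" "clear_rel k m (Id_on {1..n})"
  by (auto simp: noncrossing_equiv_def noncrossing_def clear_rel_def equiv_def refl_on_def
      sym_def trans_def)

lemma arc_rel_props:
  assumes "normal w" "w \<in> lists (X_D n)"
  shows "noncrossing_equiv n (arc_rel n w) \<and> (\<forall>k m. clear k m w \<longrightarrow> clear_rel k m (arc_rel n w))"
  using assms
proof (induction w rule: normal.induct)
  case 1
  show ?case by (simp add: arc_rel_Nil del: One_nat_def)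
next
  case (2 a b w)
  then have "linked n (arc_rel n w) a b"
    by (simp add: linked_def linked_axioms_def)
  then interpret linked n "arc_rel n w" a b .
  show ?case using link_noncrossing_equiv clear_rel_link 2 by auto
qed

lemma linked_arc_rel:
  assumes "normal (H a b # w)" "H a b # w \<in> lists (X_D n)"
  shows "linked n (arc_rel n w) a b"
  using arc_rel_props[of w n] assms by (simp add: linked_def linked_axioms_def)

lemma arc_rel_inj:
  assumes "normal w" "w \<in> lists (X_D n)" "normal v" "v \<in> lists (X_D n)"
    and "arc_rel n w = arc_rel n v"
  shows "w = v"
  using assms
proof (induction w arbitrary: v rule: normal.induct)
  have ne: "link a b r \<noteq> Id_on {1..n}" if "linked n r a b" for a b r
  proof -
    interpret linked n r a b by fact
    have "(a, b) \<in> link a b r" using rel_refl ab_in by (simp add: link_iff)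
    then show ?thesis using ab by auto
  qed
  {
    case 1
    then show ?case
    proof (cases v rule: normal.cases)
      case (2 a b v')
      then show ?thesis using ne[OF linked_arc_rel[of a b v' n]] 1 by auto
    qed simp
  next
    case (2 a b w)
    note l = linked_arc_rel[OF "2.prems"(1,2)]
    show ?case
    proof (cases v rule: normal.cases)
      case 1
      then show ?thesis using ne[OF l] 2 by auto
    next
      case v: (2 a' b' v')
      then have "linked n (arc_rel n v') a' b'" using linked_arc_rel 2 by blast
      then have "a = a' \<and> b = b' \<and> arc_rel n w = arc_rel n v'"
        using link_inj[OF l] 2 v by simp
      then show ?thesis using "2.IH"[of v'] "2.prems" v by simp
    qed
  }
qed

lemma arc_in_arc_rel:
  assumes "w \<in> lists (X_D n)" "H c d \<in> set w"
  shows "(c, d) \<in> arc_rel n w"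
  using assms
proof (induction w)
  case (Cons x w)
  obtain a b where x: "x = H a b" by (cases x)
  have "(y, y) \<in> arc_rel n w" if "y \<in> {1..n}" for y w
    using that by (induction w rule: normal.induct) (auto simp: link_def)
  moreover have "b \<in> {1..n}" using Cons.hyps x by auto
  ultimately have "(b, b) \<in> arc_rel n w" by blast
  then show ?case using Cons x by (auto simp: link_def)
qed simp

text \<open>The first letter \<open>H a b\<close> of the word joins the least point \<open>a\<close> in a non-trivial class to the
  next point \<open>b\<close> of that class.\<close>

lemma arc_rel_surj:
  assumes "noncrossing_equiv n r"
  shows "\<exists>w. normal w \<and> w \<in> lists (X_D n) \<and> arc_rel n w = r"
  using assms
proof (induction "card r" arbitrary: r rule: less_induct)
  case less
  interpret noncrossing_equiv n r by fact
  have "r \<subseteq> {1..n} \<times> {1..n}" using rel_in by auto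
  then have fin: "finite r" by (rule finite_subset) simp
  show ?case
  proof (cases "\<exists>x y. (x, y) \<in> r \<and> x \<noteq> y")
    case False
    then have "r = Id_on {1..n}" using rel_in rel_refl by (auto simp: Id_on_iff)
    then show ?thesis by (intro exI[of _ "[]"]) auto
  next
    case True
    define a where "a = (LEAST a. \<exists>y. (a, y) \<in> r \<and> a \<noteq> y)"
    have "\<exists>y. (a, y) \<in> r \<and> a \<noteq> y" unfolding a_def using True by (rule LeastI_ex)
    moreover have a_least: "a \<le> x" if "(x, y) \<in> r" "x \<noteq> y" for x y
      unfolding a_def using that by (intro Least_le) blast
    moreover define b where "b = (LEAST b. (a, b) \<in> r \<and> a \<noteq> b)"
    ultimately have b: "(a, b) \<in> r" "a \<noteq> b" unfolding b_def by (metis (mono_tags, lifting) LeastI)+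
    have b_least: "b \<le> y" if "(a, y) \<in> r" "a \<noteq> y" for y
      unfolding b_def using that by (intro Least_le) blast
    have ab: "a < b" using a_least[of b a] b rel_sym by auto
    \<comment> \<open>Isolating \<open>a\<close> keeps the rest of its class together, with
      \<open>b\<close> as the new least point.\<close>
    define s where "s = {(x, y) \<in> r. x = y \<or> x \<noteq> a \<and> y \<noteq> a}"
    have s_iff: "(x, y) \<in> s \<longleftrightarrow> (x, y) \<in> r \<and> (x = y \<or> x \<noteq> a \<and> y \<noteq> a)" for x y
      by (auto simp: s_def)
    have "equiv {1..n} s"
    proof (rule equivI)
      show "s \<subseteq> {1..n} \<times> {1..n}" using rel_in by (auto simp: s_def)
      show "refl_on {1..n} s" using rel_refl by (auto simp: refl_on_def s_def)
      show "sym s" by (rule symI) (use rel_sym s_iff in blast)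
      show "trans s"
      proof (rule transI)
        fix x y z assume "(x, y) \<in> s" "(y, z) \<in> s"
        then show "(x, z) \<in> s" using rel_trans[of x y z] by (auto simp: s_iff)
      qed
    qed
    moreover have "noncrossing s"
      unfolding noncrossing_def
    proof (intro allI impI, elim conjE)
      fix x y z t assume *: "x < y" "y < z" "z < t" "(x, z) \<in> s" "(y, t) \<in> s"
      then have "(x, z) \<in> r" "(y, t) \<in> r" "x \<noteq> a" "y \<noteq> a" by (auto simp: s_iff)
      then show "(x, y) \<in> s" using crossing[OF *(1-3)] by (simp add: s_iff)
    qed
    ultimately have s: "noncrossing_equiv n s" by (rule noncrossing_equiv.intro)
    have "clear_rel a b s"
      unfolding clear_rel_def
    proof (intro allI impI, elim conjE)
      fix x y assume xy: "(x, y) \<in> s" "x \<noteq> y"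
      then have r: "(x, y) \<in> r" "(y, x) \<in> r" "x \<noteq> a" "y \<noteq> a" using rel_sym by (auto simp: s_iff)
      have lt: "a < x" "a < y" using a_least[OF r(1)] a_least[OF r(2)] xy r by auto
      \<comment> \<open>From strictly between \<open>a\<close> and \<open>b\<close> no related point
        is at or beyond \<open>b\<close>: reaching \<open>b\<close> would put \<open>x\<close> in
        the class of \<open>a\<close> before \<open>b\<close>, and passing \<open>b\<close> would
        cross \<open>(a, b)\<close> with the same effect.\<close>
      have cut: "y < b" if xy: "(x, y) \<in> r" "a < x" "x < b" for x y
      proof (rule ccontr)
        assume "\<not> y < b"
        then consider "y = b" | "b < y" by linarith
        then have "(a, x) \<in> r"
        proof cases
          case 1
          then show ?thesis using xy b rel_sym rel_trans by blast
        next
          case 2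
          then show ?thesis using crossing[OF xy(2,3) 2 b(1) xy(1)] by simp
        qed
        then show False using b_least[of x] xy by simp
      qed
      show "a < x \<and> a < y \<and> (x < b \<longleftrightarrow> y < b)"
        using lt cut[of x y] cut[of y x] r by blast
    qed
    then have l: "linked n s a b"
      using s rel_in[OF b(1)] ab by (simp add: linked_def linked_axioms_def)
    interpret l: linked n s a b by fact
    have link: "link a b s = r"
    proof (intro equalityI subrelI)
      fix x y assume "(x, y) \<in> link a b s"
      then consider "(x, y) \<in> s" | "x = a" "(b, y) \<in> s" | "y = a" "(b, x) \<in> s"
        unfolding l.link_iff by blast
      then show "(x, y) \<in> r"
      proof cases
        case 2
        then show ?thesis using rel_trans[OF b(1), of y] by (simp add: s_iff)
      next
        case 3
        then show ?thesis using rel_trans[OF b(1), of x] rel_sym[of a x] by (simp add: s_iff)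
      qed (simp add: s_iff)
    next
      fix x y assume xy: "(x, y) \<in> r"
      consider "x = y \<or> x \<noteq> a \<and> y \<noteq> a" | "x = a" "y \<noteq> a" | "y = a" "x \<noteq> a" by blast
      then show "(x, y) \<in> link a b s"
      proof cases
        case 1
        then show ?thesis using xy by (simp add: l.link_iff s_iff)
      next
        case 2
        then have "(b, y) \<in> r" using xy b(1) rel_sym rel_trans by blast
        then show ?thesis using 2 b(2) by (simp add: l.link_iff s_iff)
      next
        case 3
        then have "(b, x) \<in> r" using xy b(1) rel_sym rel_trans by blast
        then show ?thesis using 3 b(2) by (simp add: l.link_iff s_iff)
      qed
    qed
    have "s \<subseteq> r" "(a, b) \<notin> s" using b by (auto simp: s_iff)
    then have "s \<subset> r" using b by blast
    then have "card s < card r" using fin by (rule psubset_card_mono[rotated])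
    then obtain w where w: "normal w" "w \<in> lists (X_D n)" "arc_rel n w = s"
      using less.hyps s by blast
    have "clear a b w"
      unfolding clear_def
    proof (intro allI impI)
      fix c d assume cd: "H c d \<in> set w"
      then have "H c d \<in> X_D n" using w(2) by auto
      then have "c < d" by simp
      then show "a < c \<and> (b \<le> c \<or> d < b)"
        using clear_relD[OF l.cl, of c d] arc_in_arc_rel[OF w(2) cd] w(3) by auto
    qed
    then have "normal (H a b # w)" "H a b # w \<in> lists (X_D n)" "arc_rel n (H a b # w) = r"
      using w l.a1 l.ab l.bn link by simp_all
    then show ?thesis by blast
  qed
qed

section \<open>The presentation\<close>

fun letter_labels :: "nat \<Rightarrow> letter \<Rightarrow> (nat set \<times> nat set) set" where
  "letter_labels n (H i j) = h_labels n i j"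

fun word_labels :: "nat \<Rightarrow> letter list \<Rightarrow> (nat set \<times> nat set) set" where
  "word_labels n [] = Id_on (Pow {1..n})"
| "word_labels n (x # w) = letter_labels n x O word_labels n w"

lemma Id_on_O_word_labels: "Id_on (Pow {1..n}) O word_labels n w = word_labels n w"
proof (cases w)
  case (Cons x w')
  have "Id_on (Pow {1..n}) O letter_labels n x = letter_labels n x"
    by (cases x) (auto simp: h_labels_def)
  then show ?thesis using Cons by (simp add: O_assoc[symmetric])
qed auto

lemma word_labels_append: "word_labels n (u @ v) = word_labels n u O word_labels n v"
  by (induction u) (simp_all add: Id_on_O_word_labels O_assoc del: One_nat_def)

lemma R_D_word_labels:
  assumes "(u, v) \<in> R_D n"
  shows "word_labels n u = word_labels n v"
  using assms unfolding R_D_def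
proof (elim UnE CollectE case_prodE exE conjE)
  fix i j k l assume "(u, v) = ([H i j, H k l], [H k l])" "k \<le> i" "i < j" "j \<le> l"
  then show ?thesis by (simp add: h_labels_absorb del: One_nat_def)
next
  fix i j k l assume "(u, v) = ([H i j, H k l], [H k l, H i j])" "i < j" "j \<le> k" "k < l"
  then show ?thesis
    using h_labels_disjoint[of i j k l n] h_labels_disjoint[of k l i j n]
      join_labels_commute[of n i j k l] by (simp del: One_nat_def)
next
  fix i j k assume "(u, v) = ([H i j, H j k], [H i k, H i j])" "i < j" "j < k"
  then show ?thesis
    using h_labels_disjoint[of i j j k n] h_labels_split[of i j k i j n] by (simp del: One_nat_def)
next
  fix i j k assume "(u, v) = ([H i k, H i j], [H i k, H j k])" "i < j" "j < k"
  then show ?thesis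
    using h_labels_split[of i j k j k n] h_labels_split[of i j k i j n] by (simp del: One_nat_def)
qed

text \<open>Equality of \<open>word_labels\<close> is itself a congruence containing the relations,
  so it contains the least one.\<close>

lemma word_cong_word_labels:
  assumes "(u, v) \<in> word_cong n"
  shows "word_labels n u = word_labels n v"
proof -
  define r where "r = {(u, v). u \<in> lists (X_D n) \<and> v \<in> lists (X_D n) \<and>
    word_labels n u = word_labels n v}"
  have "is_congruence (free_monoid (X_D n)) r"
    by (auto simp: is_congruence_def r_def free_monoid_def equiv_def refl_on_def sym_def trans_def
        word_labels_append)
  moreover have "R_D n \<subseteq> r"
    using R_D_subset[of n] R_D_word_labels unfolding r_def by blast
  ultimately have "word_cong n \<subseteq> r" by (rule word_cong_least)
  then show ?thesis using assms unfolding r_def by blast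
qed

section \<open>The evaluation morphism, its image and its kernel\<close>

lemma D_monoid_simps [simp]:
  "mult (D_monoid n) = part_mult n" "one (D_monoid n) = one (partition_monoid n)"
  "carrier (D_monoid n) = {d_part n \<eta> |\<eta>. planar n \<eta>}"
  by (simp_all add: D_monoid_def partition_monoid_def)

lemma \<delta>_D_simps [simp]:
  "\<delta>_D n [] = one (partition_monoid n)"
  "\<delta>_D n (x # w) = part_mult n (letter_part n x) (\<delta>_D n w)"
  by (simp_all add: \<delta>_D_def word_eval_def)

lemma partition_on_Union: "partition_on A a \<Longrightarrow> \<Union>a \<subseteq> A"
  by (simp add: partition_on_def)

lemma \<delta>_D_labels:
  assumes "w \<in> lists (X_D n)"
  shows "partition_on (verts n) (\<delta>_D n w) \<and> labels n (\<delta>_D n w) = word_labels n w"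
  using assms
proof (induction w)
  case Nil
  then show ?case by (simp add: partition_on_one labels_one)
next
  case (Cons x w)
  obtain i j where x: "x = H i j" by (cases x)
  then have ij: "1 \<le> i" "i < j" "j \<le> n" using Cons.hyps(1) by auto
  have *: "\<Union>(h_part n i j) \<subseteq> verts n" "\<Union>(\<delta>_D n w) \<subseteq> verts n"
    using partition_on_h_part[OF ij] Cons.IH partition_on_Union by blast+
  show ?case
    using Cons.IH partition_on_part_mult[OF *] labels_part_mult[OF *] labels_h_part[OF ij] x by simp
qed

lemma \<delta>_D_eq_iff:
  assumes "u \<in> lists (X_D n)" "v \<in> lists (X_D n)"
  shows "\<delta>_D n u = \<delta>_D n v \<longleftrightarrow> word_labels n u = word_labels n v"
  using \<delta>_D_labels[OF assms(1)] \<delta>_D_labels[OF assms(2)] labels_inj by metis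

text \<open>As \<open>\<delta>_D\<close> folds from the right, this is where associativity of the
  product enters; it is that of \<open>O\<close>, pulled back along the injectivity of
  \<open>labels\<close>.\<close>

lemma \<delta>_D_append:
  assumes "u \<in> lists (X_D n)" "v \<in> lists (X_D n)"
  shows "\<delta>_D n (u @ v) = part_mult n (\<delta>_D n u) (\<delta>_D n v)"
proof (rule labels_inj)
  note u = \<delta>_D_labels[OF assms(1)] and v = \<delta>_D_labels[OF assms(2)]
  have uv: "u @ v \<in> lists (X_D n)" using assms by simp
  have *: "\<Union>(\<delta>_D n u) \<subseteq> verts n" "\<Union>(\<delta>_D n v) \<subseteq> verts n"
    using u v partition_on_Union by blast+
  show "partition_on (verts n) (\<delta>_D n (u @ v))" using \<delta>_D_labels[OF uv] by blast
  show "partition_on (verts n) (part_mult n (\<delta>_D n u) (\<delta>_D n v))"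
    by (rule partition_on_part_mult[OF *])
  show "labels n (\<delta>_D n (u @ v)) = labels n (part_mult n (\<delta>_D n u) (\<delta>_D n v))"
    using \<delta>_D_labels[OF uv] u v labels_part_mult[OF *] by (simp add: word_labels_append)
qed

lemma d_labels_Id: "d_labels n (Id_on {1..n}) = Id_on (Pow {1..n})"
proof (intro equalityI subrelI)
  fix P Q assume "(P, Q) \<in> d_labels n (Id_on {1..n})"
  note PQ = d_labelsD[OF this]
  have "x \<in> P \<longleftrightarrow> x \<in> Q" if "x \<in> {1..n}" for x
    using that by (intro PQ(4)[of x x]) (auto simp: outer_def)
  then have "P = Q" using PQ(1,2) by blast
  then show "(P, Q) \<in> Id_on (Pow {1..n})" using PQ(1) by auto
next
  fix P Q assume "(P, Q) \<in> Id_on (Pow {1..n})"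
  then have "P = Q" "P \<subseteq> {1..n}" by auto
  then show "(P, Q) \<in> d_labels n (Id_on {1..n})" by (intro d_labelsI) auto
qed

lemma word_labels_normal:
  assumes "normal w" "w \<in> lists (X_D n)"
  shows "word_labels n w = d_labels n (arc_rel n w)"
  using assms
proof (induction w rule: normal.induct)
  case (2 a b w)
  interpret linked n "arc_rel n w" a b by (rule linked_arc_rel[OF "2.prems"])
  show ?case using 2 h_labels_O_d_labels by simp
qed (use d_labels_Id in simp)

lemma \<delta>_D_normal:
  assumes "normal w" "w \<in> lists (X_D n)"
  shows "\<delta>_D n w = d_part n (arc_rel n w)"
proof -
  interpret noncrossing_equiv n "arc_rel n w" using arc_rel_props[OF assms] by blast
  show ?thesis
    using \<delta>_D_labels[OF assms(2)] partition_on_d_part labels_d_part word_labels_normal[OF assms]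
    by (intro labels_inj) auto
qed

text \<open>Also the source of closure under products: the product of two values of words is the
  value of their concatenation, which spares computing products of \<open>d_part\<close>s.\<close>

lemma \<delta>_D_image: "\<delta>_D n ` lists (X_D n) = {d_part n \<eta> |\<eta>. planar n \<eta>}"
proof (intro equalityI subsetI)
  fix a assume "a \<in> \<delta>_D n ` lists (X_D n)"
  then obtain w where w: "w \<in> lists (X_D n)" "a = \<delta>_D n w" by blast
  obtain v where v: "normal v" "(w, v) \<in> word_cong n" using normal_form_exists[OF w(1)] by blast
  have vX: "v \<in> lists (X_D n)" using word_cong_lists[OF v(2)] by blast
  interpret noncrossing_equiv n "arc_rel n v" using arc_rel_props[OF v(1) vX] by blast
  have "\<delta>_D n w = \<delta>_D n v"
    unfolding \<delta>_D_eq_iff[OF w(1) vX] by (rule word_cong_word_labels[OF v(2)])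
  then have "a = d_part n (arc_rel n v)" using \<delta>_D_normal[OF v(1) vX] w(2) by simp
  then show "a \<in> {d_part n \<eta> |\<eta>. planar n \<eta>}" using planar by blast
next
  fix a assume "a \<in> {d_part n \<eta> |\<eta>. planar n \<eta>}"
  then obtain \<eta> where \<eta>: "a = d_part n \<eta>" "planar n \<eta>" by blast
  then have "noncrossing_equiv n \<eta>"
    using planar_imp_noncrossing by (simp add: noncrossing_equiv_def planar_def)
  then obtain w where "normal w" "w \<in> lists (X_D n)" "arc_rel n w = \<eta>"
    using arc_rel_surj by blast
  then have "\<delta>_D n w = a" "w \<in> lists (X_D n)" using \<delta>_D_normal \<eta>(1) by simp_all
  then show "a \<in> \<delta>_D n ` lists (X_D n)" by blast
qed

lemma \<delta>_D_kernel:
  "{(u, v). u \<in> lists (X_D n) \<and> v \<in> lists (X_D n) \<and> \<delta>_D n u = \<delta>_D n v} = word_cong n"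
proof (intro equalityI subrelI)
  fix u v assume "(u, v) \<in> {(u, v). u \<in> lists (X_D n) \<and> v \<in> lists (X_D n) \<and> \<delta>_D n u = \<delta>_D n v}"
  then have uv: "u \<in> lists (X_D n)" "v \<in> lists (X_D n)" "\<delta>_D n u = \<delta>_D n v" by blast+
  obtain u' where u': "normal u'" "(u, u') \<in> word_cong n" using normal_form_exists[OF uv(1)] by blast
  obtain v' where v': "normal v'" "(v, v') \<in> word_cong n" using normal_form_exists[OF uv(2)] by blast
  have X: "u' \<in> lists (X_D n)" "v' \<in> lists (X_D n)"
    using word_cong_lists u'(2) v'(2) by blast+
  have "word_labels n u' = word_labels n v'"
    using uv word_cong_word_labels[OF u'(2)] word_cong_word_labels[OF v'(2)] by (simp add: \<delta>_D_eq_iff)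
  then have eq: "d_part n (arc_rel n u') = d_part n (arc_rel n v')"
    using \<delta>_D_normal[OF u'(1) X(1)] \<delta>_D_normal[OF v'(1) X(2)] \<delta>_D_eq_iff[OF X] by simp
  interpret U: noncrossing_equiv n "arc_rel n u'" using arc_rel_props[OF u'(1) X(1)] by blast
  interpret V: noncrossing_equiv n "arc_rel n v'" using arc_rel_props[OF v'(1) X(2)] by blast
  \<comment> \<open>The lower parts of the blocks are exactly the classes, so equal partitions come
    from equal equivalences.\<close>
  have "(x, y) \<in> arc_rel n u' \<longleftrightarrow> (x, y) \<in> arc_rel n v'" for x y
    unfolding U.rel_iff_d_part V.rel_iff_d_part eq ..
  then have "arc_rel n u' = arc_rel n v'" by auto
  then have "u' = v'" using arc_rel_inj[OF u'(1) X(1) v'(1) X(2)] by blast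
  then show "(u, v) \<in> word_cong n" using u'(2) v'(2) word_cong_sym word_cong_trans by blast
next
  fix u v assume uv: "(u, v) \<in> word_cong n"
  then have "u \<in> lists (X_D n)" "v \<in> lists (X_D n)" using word_cong_lists by blast+
  then show "(u, v) \<in> {(u, v). u \<in> lists (X_D n) \<and> v \<in> lists (X_D n) \<and> \<delta>_D n u = \<delta>_D n v}"
    using word_cong_word_labels[OF uv] \<delta>_D_eq_iff by blast
qed

text \<open>All laws are inherited from concatenation of words through the surjection
  \<open>\<delta>_D n\<close>, by \<open>\<delta>_D_append\<close>.\<close>

lemma monoid_D_monoid: "monoid (D_monoid n)"
proof -
  note carr = \<delta>_D_image[of n, symmetric]
  have app: "part_mult n (\<delta>_D n u) (\<delta>_D n v) \<in> \<delta>_D n ` lists (X_D n)"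
    if "u \<in> lists (X_D n)" "v \<in> lists (X_D n)" for u v
    using \<delta>_D_append[OF that] that by (intro image_eqI[of _ _ "u @ v"]) auto
  have assoc: "part_mult n (part_mult n (\<delta>_D n u) (\<delta>_D n v)) (\<delta>_D n w) =
      part_mult n (\<delta>_D n u) (part_mult n (\<delta>_D n v) (\<delta>_D n w))"
    if "u \<in> lists (X_D n)" "v \<in> lists (X_D n)" "w \<in> lists (X_D n)" for u v w
    using that by (simp only: \<delta>_D_append[symmetric] append_in_lists_conv append_assoc simp_thms)
  have unit: "part_mult n (\<delta>_D n []) (\<delta>_D n w) = \<delta>_D n w"
    "part_mult n (\<delta>_D n w) (\<delta>_D n []) = \<delta>_D n w" if "w \<in> lists (X_D n)" for w
    using \<delta>_D_append[of "[]" n w] \<delta>_D_append[of w n "[]"] that by simp_all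
  have Nil: "\<delta>_D n [] \<in> \<delta>_D n ` lists (X_D n)" by blast
  show ?thesis
  proof (rule monoidI, unfold D_monoid_simps carr \<delta>_D_simps(1)[symmetric])
    show "\<delta>_D n [] \<in> \<delta>_D n ` lists (X_D n)" by (rule Nil)
  next
    fix x y assume "x \<in> \<delta>_D n ` lists (X_D n)" "y \<in> \<delta>_D n ` lists (X_D n)"
    then show "part_mult n x y \<in> \<delta>_D n ` lists (X_D n)" by (elim imageE) (simp only: app)
  next
    fix x y z
    assume "x \<in> \<delta>_D n ` lists (X_D n)" "y \<in> \<delta>_D n ` lists (X_D n)" "z \<in> \<delta>_D n ` lists (X_D n)"
    then show "part_mult n (part_mult n x y) z = part_mult n x (part_mult n y z)"
      by (elim imageE) (simp only: assoc)
  next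
    fix x assume "x \<in> \<delta>_D n ` lists (X_D n)"
    then show "part_mult n (\<delta>_D n []) x = x" "part_mult n x (\<delta>_D n []) = x"
      by (elim imageE; simp only: unit)+
  qed
qed

theorem theorem9p11:
  fixes n :: nat
  assumes "n \<ge> 2"
  shows "has_monoid_presentation (D_monoid n) (X_D n) (R_D n) (\<delta>_D n)"
proof -
  have "\<delta>_D n \<in> hom (free_monoid (X_D n)) (D_monoid n)"
    unfolding hom_def using \<delta>_D_image[of n] \<delta>_D_append[of _ n] by (auto simp: free_monoid_def)
  then show ?thesis
    unfolding has_monoid_presentation_def
    using monoid_D_monoid R_D_subset \<delta>_D_image[of n] \<delta>_D_kernel[of n]
    by (simp add: word_cong_def)
qed

end
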